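(* If $|c|<(n+1)\pi/2$, then $\mathcal F_c=\{A\in\mathrm{Sym}(\mathbb R^{n+1}):\widetilde\Theta(A)\ge c\}$ is a subequation, and its dual is $\widetilde{\mathcal F_c}=\mathcal F_{-c}$.
   Context: Notation for $A=[a_{ij}]_{i,j=0}^n\in\mathrm{Sym}(\mathbb R^{n+1})$: $A^+=[a_{ij}]_{i,j=1}^n$, $I_n=\mathrm{diag}(0,1,\dots,1)$, $\mathcal S=\{A:A=\mathrm{diag}(0,A^+)\}$; $\arg$ has values in $(-\pi,\pi]$ and $\tan^{-1}$ in $(-\pi/2,\pi/2)$, applied to symmetric matrices via eigenvalues. $\widetilde\Theta(A)=\sum_{\lambda\in\mathrm{spec}(I_n+\sqrt{-1}A)}m(\lambda)\arg\lambda$ ($m$ = algebraic multiplicity) for $A\notin\mathcal S$, and $\widetilde\Theta(A)=\pi/2+\mathrm{tr}\tan^{-1}(A^+)$ for $A\in\mathcal S$. A subequation is a nonempty proper closed subset $F\subset\mathrm{Sym}(\mathbb R^m)$ with $F+\mathcal P\subseteq F$, where $\mathcal P$ is the set of positive semidefinite matrices. The dual of $F$ is $\widetilde F=\mathrm{Sym}(\mathbb R^m)\setminus(-\mathrm{Int}\,F)$. *)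

theory Defs
  imports "HOL-Analysis.Analysis" "Jordan_Normal_Form.Matrix" "Jordan_Normal_Form.Char_Poly"
begin

definition sym_mats :: "nat \<Rightarrow> real mat set" where
  "sym_mats m = {A. A \<in> carrier_mat m m \<and> transpose_mat A = A}"

definition psd_mats :: "nat \<Rightarrow> real mat set" where
  "psd_mats m = {A. A \<in> sym_mats m \<and> (\<forall>v \<in> carrier_vec m. v \<bullet> (A *\<^sub>v v) \<ge> 0)}"

text \<open>Closedness in Sym(R^m) (finite-dimensional, Euclidean topology), phrased sequentially
  via entrywise convergence.\<close>
definition closed_sym :: "nat \<Rightarrow> real mat set \<Rightarrow> bool" where
  "closed_sym m F \<longleftrightarrow> (\<forall>X A. (\<forall>k. X k \<in> F) \<and> A \<in> sym_mats m \<and>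
      (\<forall>i<m. \<forall>j<m. (\<lambda>k. X k $$ (i,j)) \<longlonglongrightarrow> A $$ (i,j)) \<longrightarrow> A \<in> F)"

definition int_sym :: "nat \<Rightarrow> real mat set \<Rightarrow> real mat set" where
  "int_sym m F = {A \<in> sym_mats m. \<exists>e>0. \<forall>B \<in> sym_mats m.
      (\<forall>i<m. \<forall>j<m. \<bar>B $$ (i,j) - A $$ (i,j)\<bar> < e) \<longrightarrow> B \<in> F}"

definition subequation :: "nat \<Rightarrow> real mat set \<Rightarrow> bool" where
  "subequation m F \<longleftrightarrow> F \<subseteq> sym_mats m \<and> F \<noteq> {} \<and> F \<noteq> sym_mats m \<and> closed_sym m F \<and>
      (\<forall>A\<in>F. \<forall>P\<in>psd_mats m. A + P \<in> F)"

definition dual_subeq :: "nat \<Rightarrow> real mat set \<Rightarrow> real mat set" where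
  "dual_subeq m F = {A \<in> sym_mats m. - A \<notin> int_sym m F}"

definition Aplus :: "nat \<Rightarrow> real mat \<Rightarrow> real mat" where
  "Aplus n A = mat n n (\<lambda>(i,j). A $$ (i+1, j+1))"

definition in_S :: "nat \<Rightarrow> real mat \<Rightarrow> bool" where
  "in_S n A \<longleftrightarrow> (\<forall>i\<le>n. A $$ (i,0) = 0 \<and> A $$ (0,i) = 0)"

definition In_plus_iA :: "nat \<Rightarrow> real mat \<Rightarrow> complex mat" where
  "In_plus_iA n A = mat (n+1) (n+1)
     (\<lambda>(i,j). (if i = j \<and> i \<noteq> 0 then 1 else 0) + \<i> * complex_of_real (A $$ (i,j)))"

definition Theta :: "nat \<Rightarrow> real mat \<Rightarrow> real" where
  "Theta n A =
    (if in_S n A then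
       pi/2 + (\<Sum>x\<in>{x. poly (char_poly (Aplus n A)) x = 0}.
                 real (order x (char_poly (Aplus n A))) * arctan x)
     else
       (\<Sum>z\<in>{z. poly (char_poly (In_plus_iA n A)) z = 0}.
                 real (order z (char_poly (In_plus_iA n A))) * Arg z))"

definition Fc :: "nat \<Rightarrow> real \<Rightarrow> real mat set" where
  "Fc n c = {A \<in> sym_mats (n+1). Theta n A \<ge> c}"

end

theory Submission
  imports Defs
begin

text \<open>
  Eliminating the block \<open>I + \<i> A\<^sup>+\<close> from \<open>B = I\<^sub>n + \<i> A\<close> leaves the pivot
  \<open>s = det B / det (I + \<i> A\<^sup>+)\<close>, which depends continuously on \<open>A\<close>, lies in the closed right half
  plane and vanishes exactly on \<open>\<S>\<close>. The angle of \<open>A\<close> is \<open>tr arctan A\<^sup>+ + arg s\<close>, with the convention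
  \<open>arg 0 = \<pi>/2\<close>: off \<open>\<S>\<close> both sides are continuous branches of \<open>arg det\<close> along the segment from the
  identity to \<open>B\<close>. Upper semicontinuity is then immediate. Monotonicity holds after replacing \<open>I\<^sub>n\<close> by
  \<open>diag(\<epsilon>, 1, \<dots>, 1)\<close>, because adding \<open>\<i> P\<close> to a matrix \<open>M\<close> with positive definite real part multiplies the
  determinant by \<open>\<Prod>(1 + \<i> l)\<close> with \<open>l\<close> ranging over the eigenvalues of \<open>M\<inverse> P\<close>, and \<open>l = 0\<close> or
  \<open>Re l > 0\<close>. For the dual, the angle of \<open>- A\<close> is at least minus that of \<open>A\<close>, with equality off \<open>\<S>\<close>,
  and the shift \<open>A - \<epsilon> I\<close> strictly lowers the angle below minus the angle of \<open>- A\<close>,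
  except for \<open>n = 0\<close>, where the bound on \<open>c\<close> is used instead.
\<close>

subsection \<open>Spectra of affine images and lifts of the argument\<close>

text \<open>Eigenvalues are kept in a list, repeated by algebraic multiplicity, so that affine
  images become maps and the determinant becomes a product. The field is general because both real
  and complex matrices occur.\<close>

definition spectrum_list :: "nat \<Rightarrow> 'a::field mat \<Rightarrow> 'a list \<Rightarrow> bool" where
  "spectrum_list m M as \<longleftrightarrow>
     M \<in> carrier_mat m m \<and> char_poly M = (\<Prod>a\<leftarrow>as. [:- a, 1:]) \<and> length as = m"

text \<open>The formula of \<open>Theta\<close> off \<open>\<S>\<close>, freed from its special
  matrix so that it also applies to blocks and perturbations. A zero eigenvalue contributes nothing,
  since \<open>Arg 0 = 0\<close>.\<close>

definition phase :: "complex mat \<Rightarrow> real" where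
  "phase M = (\<Sum>z\<in>{z. poly (char_poly M) z = 0}. real (order z (char_poly M)) * Arg z)"

lemma spectrum_list_exists:
  fixes M :: "complex mat"
  assumes "M \<in> carrier_mat m m"
  shows "\<exists>as. spectrum_list m M as"
  using char_poly_factorized[OF assms] assms unfolding spectrum_list_def by auto

lemma sum_roots_eq_sum_list:
  fixes f :: "'a::field \<Rightarrow> real"
  assumes p: "p = (\<Prod>a\<leftarrow>as. [:- a, 1:])"
  shows "(\<Sum>z\<in>{z. poly p z = 0}. real (order z p) * f z) = (\<Sum>a\<leftarrow>as. f a)"
proof -
  have ord: "order z p = count_list as z" for z
  proof -
    have "order z (\<Prod>a\<leftarrow>as. [:- a, 1:]) = count_list as z"
    proof (induction as)
      case (Cons a as)
      have nz: "(\<Prod>a\<leftarrow>as. [:- a, 1:]) \<noteq> 0" by (auto simp: prod_list_zero_iff)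
      have "order z [:- a, 1:] = (if a = z then 1 else 0)"
        using order_power_n_n[of z 1] by (auto intro: order_0I)
      with Cons nz show ?case by (auto simp: order_mult simp del: mult_pCons_left)
    qed auto
    then show ?thesis using p by simp
  qed
  have roots: "{z. poly p z = 0} = set as"
    unfolding p by (auto simp: poly_prod_list prod_list_zero_iff)
  \<comment> \<open>The summation range is a fixed finite superset, since the set of roots itself
    changes during the induction on the list.\<close>
  have "(\<Sum>z\<in>S. real (count_list bs z) * f z) = (\<Sum>b\<leftarrow>bs. f b)"
    if "finite S" "set bs \<subseteq> S" for S bs
    using that(2)
  proof (induction bs)
    case (Cons b bs)
    have "(\<Sum>z\<in>S. real (count_list (b # bs) z) * f z)
        = (\<Sum>z\<in>S. real (count_list bs z) * f z + (if z = b then f z else 0))"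
      by (intro sum.cong) (auto simp: algebra_simps)
    also have "\<dots> = (\<Sum>b\<leftarrow>bs. f b) + f b"
      using Cons that(1) by (simp add: sum.distrib)
    finally show ?case by simp
  qed simp
  then show ?thesis unfolding roots ord by simp
qed

lemma phase_eq_sum_list:
  assumes "spectrum_list m M as"
  shows "phase M = (\<Sum>a\<leftarrow>as. Arg a)"
  using assms unfolding phase_def spectrum_list_def by (blast intro: sum_roots_eq_sum_list)

lemma spectrum_list_eigenvector:
  assumes "spectrum_list m M as" "a \<in> set as"
  obtains v where "v \<in> carrier_vec m" "v \<noteq> 0\<^sub>v m" "M *\<^sub>v v = a \<cdot>\<^sub>v v"
proof -
  have M: "M \<in> carrier_mat m m" and "poly (char_poly M) a = 0"
    using assms unfolding spectrum_list_def by (auto simp: poly_prod_list prod_list_zero_iff)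
  then have "eigenvalue M a" by (simp add: eigenvalue_root_char_poly)
  with M that show thesis unfolding eigenvalue_def eigenvector_def by auto
qed

lemma poly_linear_factors:
  fixes x :: "'a::comm_ring_1"
  shows "poly (\<Prod>a\<leftarrow>as. [:- a, 1:]) x = (\<Prod>a\<leftarrow>as. x - a)"
  by (induction as) (auto simp: algebra_simps)

text \<open>For \<open>t \<noteq> 0\<close> the matrix is \<open>- t\<close> times
  \<open>(- a / t) I - M\<close>, so its determinant is the characteristic polynomial at
  \<open>- a / t\<close>, scaled by \<open>(- t) ^ m\<close>.\<close>

lemma det_affine:
  fixes M :: "'a::field mat"
  assumes sp: "spectrum_list m M as"
  shows "det (a \<cdot>\<^sub>m 1\<^sub>m m + t \<cdot>\<^sub>m M) = (\<Prod>l\<leftarrow>as. a + t * l)"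
proof -
  have M: "M \<in> carrier_mat m m" and len: "length as = m"
    and cp: "char_poly M = (\<Prod>a\<leftarrow>as. [:- a, 1:])"
    using sp unfolding spectrum_list_def by auto
  show ?thesis
  proof (cases "t = 0")
    case True
    then have "a \<cdot>\<^sub>m 1\<^sub>m m + t \<cdot>\<^sub>m M = a \<cdot>\<^sub>m 1\<^sub>m m" using M by (intro eq_matI) auto
    then show ?thesis using True len by (simp add: map_replicate_const prod_list_replicate)
  next
    case False
    have "a \<cdot>\<^sub>m 1\<^sub>m m + t \<cdot>\<^sub>m M = (- t) \<cdot>\<^sub>m (- char_matrix M (- a / t))"
      using M False by (intro eq_matI) (auto simp: char_matrix_def field_simps)
    then have "det (a \<cdot>\<^sub>m 1\<^sub>m m + t \<cdot>\<^sub>m M) = (- t) ^ m * poly (char_poly M) (- a / t)"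
      using M char_matrix_closed[OF M, of "- a / t"] unfolding char_poly_matrix[OF M]
      by (simp add: char_matrix_def)
    also have "\<dots> = (- t) ^ length as * (\<Prod>l\<leftarrow>as. - a / t - l)"
      unfolding cp len poly_linear_factors ..
    also have "\<dots> = (\<Prod>l\<leftarrow>as. a + t * l)"
      using False by (induction as) (auto simp: field_simps)
    finally show ?thesis .
  qed
qed

lemma det_eq_prod_list:
  assumes "spectrum_list m M as"
  shows "det M = prod_list as"
proof -
  have "0 \<cdot>\<^sub>m 1\<^sub>m m + 1 \<cdot>\<^sub>m M = M"
    using assms unfolding spectrum_list_def by (intro eq_matI) auto
  then show ?thesis using det_affine[OF assms, of 0 1] by simp
qed

text \<open>At a point \<open>x\<close> the characteristic polynomial of \<open>a I + t M\<close> is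
  again the determinant of an affine image of \<open>M\<close>, with coefficients
  \<open>x - a\<close> and \<open>- t\<close>. Over an infinite field agreement at all points gives
  equality of polynomials.\<close>

lemma spectrum_list_affine:
  fixes M :: "'a::{field,ring_char_0} mat"
  assumes sp: "spectrum_list m M as"
  shows "spectrum_list m (a \<cdot>\<^sub>m 1\<^sub>m m + t \<cdot>\<^sub>m M) (map (\<lambda>l. a + t * l) as)"
proof -
  let ?N = "a \<cdot>\<^sub>m 1\<^sub>m m + t \<cdot>\<^sub>m M"
  have M: "M \<in> carrier_mat m m" and len: "length as = m"
    using sp unfolding spectrum_list_def by auto
  then have N: "?N \<in> carrier_mat m m" by auto
  have "poly (char_poly ?N) x = poly (\<Prod>l\<leftarrow>map (\<lambda>l. a + t * l) as. [:- l, 1:]) x" for x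
  proof -
    have "- char_matrix ?N x = (x - a) \<cdot>\<^sub>m 1\<^sub>m m + (- t) \<cdot>\<^sub>m M"
      using M by (intro eq_matI) (auto simp: char_matrix_def)
    then have "poly (char_poly ?N) x = (\<Prod>l\<leftarrow>as. (x - a) + (- t) * l)"
      unfolding char_poly_matrix[OF N] det_affine[OF sp, symmetric] by simp
    then show ?thesis by (simp add: poly_prod_list o_def algebra_simps)
  qed
  then have "char_poly ?N = (\<Prod>l\<leftarrow>map (\<lambda>l. a + t * l) as. [:- l, 1:])"
    by (simp add: poly_eq_poly_eq_iff[symmetric] fun_eq_iff)
  with N len show ?thesis unfolding spectrum_list_def by simp
qed

text \<open>The values of \<open>f\<close> are multiples of \<open>2 * pi\<close>. A nonzero final
  value would force \<open>\<bar>f\<bar>\<close> through \<open>pi\<close>, where \<open>cis\<close>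
  is \<open>-1\<close>. Applied to the difference of two continuous branches of the same argument,
  this shows that they agree.\<close>

lemma continuous_lift_trivial:
  fixes f :: "real \<Rightarrow> real"
  assumes cont: "continuous_on {0..1} f" and lift: "\<And>t. t \<in> {0..1} \<Longrightarrow> cis (f t) = 1"
    and f0: "f 0 = 0"
  shows "f 1 = 0"
proof (rule ccontr)
  assume ne: "f 1 \<noteq> 0"
  have big: "\<bar>f t\<bar> \<noteq> pi" if "t \<in> {0..1}" for t
  proof
    assume "\<bar>f t\<bar> = pi"
    then have "cos (f t) = -1" by (metis cos_abs_real cos_pi)
    moreover have "cos (f t) = 1" using lift[OF that] by (metis cis.sel(1) one_complex.sel(1))
    ultimately show False by simp
  qed
  have "pi \<le> \<bar>f 1\<bar>"
  proof (rule ccontr)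
    assume less: "\<not> pi \<le> \<bar>f 1\<bar>"
    have "cos (f 1) = 1" using lift[of 1] by (metis atLeastAtMost_iff cis.sel(1) one_complex.sel(1) order_refl zero_le_one)
    then obtain k :: int where "f 1 = of_int k * 2 * pi" using cos_one_2pi_int by blast
    moreover from this ne have "\<bar>k\<bar> \<ge> 1" by auto
    then have "\<bar>real_of_int k\<bar> \<ge> 1" by linarith
    ultimately have "\<bar>f 1\<bar> \<ge> 2 * pi" by (simp add: abs_mult)
    with less show False using pi_gt_zero by linarith
  qed
  moreover have "continuous_on {0..1} (\<lambda>t. \<bar>f t\<bar>)" using cont by (intro continuous_intros)
  ultimately obtain t where "0 \<le> t" "t \<le> 1" "\<bar>f t\<bar> = pi"
    using IVT'[of "\<lambda>t. \<bar>f t\<bar>" 0 pi 1] f0 by auto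
  with big show False by auto
qed

text \<open>Together with \<open>det_eq_prod_list\<close> this makes the phase a branch of the
  argument of the determinant.\<close>

lemma cis_sum_list_Arg:
  assumes "0 \<notin> set as"
  shows "cis (\<Sum>a\<leftarrow>as. Arg a) = sgn (prod_list as)"
  using assms by (induction as) (auto simp: cis_mult[symmetric] cis_Arg sgn_mult)

subsection \<open>Accretive matrices\<close>

text \<open>The form is \<open>v* M v\<close>: the condition says that the Hermitian part of
  \<open>M\<close> is positive semidefinite, or positive definite in the strict version
  below.\<close>

definition accretive :: "nat \<Rightarrow> complex mat \<Rightarrow> bool" where
  "accretive m M \<longleftrightarrow> M \<in> carrier_mat m m \<and> (\<forall>v\<in>carrier_vec m. 0 \<le> Re ((M *\<^sub>v v) \<bullet>c v))"

definition strictly_accretive :: "nat \<Rightarrow> complex mat \<Rightarrow> bool" where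
  "strictly_accretive m M \<longleftrightarrow>
     M \<in> carrier_mat m m \<and> (\<forall>v\<in>carrier_vec m. v \<noteq> 0\<^sub>v m \<longrightarrow> 0 < Re ((M *\<^sub>v v) \<bullet>c v))"

lemma quadratic_form_eq:
  fixes M :: "complex mat"
  assumes "M \<in> carrier_mat m m" "v \<in> carrier_vec m"
  shows "(M *\<^sub>v v) \<bullet>c v = (\<Sum>i<m. \<Sum>j<m. M $$ (i,j) * v $ j * cnj (v $ i))"
  using assms by (auto simp: scalar_prod_def mult_mat_vec_def conjugate_complex_def atLeast0LessThan
      sum_distrib_right intro!: sum.cong)

lemma cscalar_prod_self:
  fixes v :: "complex vec"
  assumes "v \<in> carrier_vec m"
  shows "v \<bullet>c v = of_real (\<Sum>i<m. (cmod (v $ i))\<^sup>2)"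
  using assms by (auto simp: scalar_prod_def conjugate_complex_def atLeast0LessThan
      complex_norm_square[symmetric] intro!: sum.cong)

lemma cscalar_prod_self_pos:
  fixes v :: "complex vec"
  assumes "v \<in> carrier_vec m" "v \<noteq> 0\<^sub>v m"
  shows "0 < (\<Sum>i<m. (cmod (v $ i))\<^sup>2)"
proof -
  obtain i where "i < m" "v $ i \<noteq> 0"
    using assms by (metis carrier_vecD eq_vecI index_zero_vec(1,2))
  then show ?thesis by (intro sum_pos2[of _ i]) auto
qed

lemma strictly_accretive_imp_accretive:
  assumes "strictly_accretive m M"
  shows "accretive m M"
  unfolding accretive_def
proof (intro conjI ballI)
  show M: "M \<in> carrier_mat m m" using assms unfolding strictly_accretive_def by simp
  fix v :: "complex vec" assume v: "v \<in> carrier_vec m"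
  show "0 \<le> Re ((M *\<^sub>v v) \<bullet>c v)"
  proof (cases "v = 0\<^sub>v m")
    case True
    then show ?thesis using M by (simp add: quadratic_form_eq)
  next
    case False
    then show ?thesis using assms v unfolding strictly_accretive_def by (auto intro: less_imp_le)
  qed
qed

lemma quadratic_form_eigenvector:
  fixes M :: "complex mat"
  assumes "M \<in> carrier_mat m m" "v \<in> carrier_vec m" "M *\<^sub>v v = a \<cdot>\<^sub>v v"
  shows "Re ((M *\<^sub>v v) \<bullet>c v) = Re a * (\<Sum>i<m. (cmod (v $ i))\<^sup>2)"
proof -
  have "(M *\<^sub>v v) \<bullet>c v = a * (v \<bullet>c v)" unfolding assms(3) using assms(2) by simp
  then show ?thesis unfolding cscalar_prod_self[OF assms(2)] by simp
qed

text \<open>On an eigenvector the form is the eigenvalue times the squared norm.\<close>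

lemma accretive_eigenvalue_Re:
  assumes "accretive m M" "spectrum_list m M as" "a \<in> set as"
  shows "0 \<le> Re a"
proof -
  obtain v where v: "v \<in> carrier_vec m" "v \<noteq> 0\<^sub>v m" "M *\<^sub>v v = a \<cdot>\<^sub>v v"
    using spectrum_list_eigenvector assms(2,3) by blast
  have M: "M \<in> carrier_mat m m" using assms(1) unfolding accretive_def by simp
  have "0 \<le> Re a * (\<Sum>i<m. (cmod (v $ i))\<^sup>2)"
    using quadratic_form_eigenvector[OF M v(1,3)] assms(1) v(1) unfolding accretive_def by metis
  then show ?thesis using cscalar_prod_self_pos[OF v(1,2)] by (simp add: zero_le_mult_iff)
qed

lemma strictly_accretive_mult_vec_nonzero:
  assumes "strictly_accretive m M" "v \<in> carrier_vec m" "v \<noteq> 0\<^sub>v m"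
  shows "M *\<^sub>v v \<noteq> 0\<^sub>v m"
proof
  assume "M *\<^sub>v v = 0\<^sub>v m"
  then have "(M *\<^sub>v v) \<bullet>c v = 0" using assms(2) by simp
  then show False using assms unfolding strictly_accretive_def by force
qed

lemma strictly_accretive_det_nonzero:
  assumes "strictly_accretive m M"
  shows "det M \<noteq> 0"
proof
  assume "det M = 0"
  moreover have M: "M \<in> carrier_mat m m" using assms unfolding strictly_accretive_def by simp
  ultimately obtain v where "v \<in> carrier_vec m" "v \<noteq> 0\<^sub>v m" "M *\<^sub>v v = 0\<^sub>v m"
    using det_0_iff_vec_prod_zero_field by blast
  with strictly_accretive_mult_vec_nonzero[OF assms] show False by blast
qed

text \<open>For \<open>t < 1\<close> the identity still contributes a positive multiple of the
  squared norm. Hence only the far end of the segment from the identity to \<open>M\<close> can fail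
  to be invertible.\<close>

lemma strictly_accretive_convex_one:
  assumes "accretive m M" "0 \<le> t" "t < 1"
  shows "strictly_accretive m (complex_of_real (1 - t) \<cdot>\<^sub>m 1\<^sub>m m + complex_of_real t \<cdot>\<^sub>m M)"
  unfolding strictly_accretive_def
proof (intro conjI ballI impI)
  let ?N = "complex_of_real (1 - t) \<cdot>\<^sub>m 1\<^sub>m m + complex_of_real t \<cdot>\<^sub>m M"
  have M: "M \<in> carrier_mat m m" using assms unfolding accretive_def by simp
  then show N: "?N \<in> carrier_mat m m" by simp
  fix v :: "complex vec" assume v: "v \<in> carrier_vec m" "v \<noteq> 0\<^sub>v m"
  have "?N *\<^sub>v v = complex_of_real (1 - t) \<cdot>\<^sub>v v + complex_of_real t \<cdot>\<^sub>v (M *\<^sub>v v)"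
    using M v by (intro eq_vecI) (auto simp: add_mult_distrib_mat_vec[of _ m m] simp del: of_real_diff)
  then have "(?N *\<^sub>v v) \<bullet>c v
      = complex_of_real (1 - t) * (v \<bullet>c v) + complex_of_real t * ((M *\<^sub>v v) \<bullet>c v)"
    using M v by (simp add: add_scalar_prod_distrib[of _ m] del: of_real_diff)
  then have "Re ((?N *\<^sub>v v) \<bullet>c v)
      = (1 - t) * (\<Sum>i<m. (cmod (v $ i))\<^sup>2) + t * Re ((M *\<^sub>v v) \<bullet>c v)"
    unfolding cscalar_prod_self[OF v(1)] by simp
  moreover have "0 \<le> Re ((M *\<^sub>v v) \<bullet>c v)" using assms v unfolding accretive_def by simp
  ultimately show "0 < Re ((?N *\<^sub>v v) \<bullet>c v)"
    using cscalar_prod_self_pos[OF v] assms by (simp add: add_pos_nonneg)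
qed

lemma mat_delete_0_0_index:
  assumes "M \<in> carrier_mat (Suc m) (Suc m)" "i < m" "j < m"
  shows "mat_delete M 0 0 $$ (i,j) = M $$ (Suc i, Suc j)"
  using assms unfolding mat_delete_def by simp

text \<open>The form of the block is the form of \<open>M\<close> restricted to vectors with
  vanishing coordinate 0.\<close>

lemma strictly_accretive_mat_delete:
  assumes "strictly_accretive (Suc m) M"
  shows "strictly_accretive m (mat_delete M 0 0)"
  unfolding strictly_accretive_def
proof (intro conjI ballI impI)
  have M: "M \<in> carrier_mat (Suc m) (Suc m)" using assms unfolding strictly_accretive_def by simp
  then show D: "mat_delete M 0 0 \<in> carrier_mat m m" using mat_delete_carrier[OF M] by simp
  fix v :: "complex vec" assume v: "v \<in> carrier_vec m" "v \<noteq> 0\<^sub>v m"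
  let ?w = "vCons 0 v"
  have w: "?w \<in> carrier_vec (Suc m)" "?w \<noteq> 0\<^sub>v (Suc m)" using v by (auto simp: zero_vec_Suc)
  have "(mat_delete M 0 0 *\<^sub>v v) \<bullet>c v = (M *\<^sub>v ?w) \<bullet>c ?w"
    unfolding quadratic_form_eq[OF D v(1)] quadratic_form_eq[OF M w(1)]
    by (simp add: sum.lessThan_Suc_shift mat_delete_0_0_index[OF M] del: sum.lessThan_Suc)
  then show "0 < Re ((mat_delete M 0 0 *\<^sub>v v) \<bullet>c v)"
    using assms w unfolding strictly_accretive_def by metis
qed

text \<open>With \<open>x\<close> the first column of the adjugate, \<open>M x = det M e\<^sub>0\<close> and \<open>x\<^sub>0\<close> is the minor of the remaining block.\<close>
lemma accretive_pivot_Re: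
  assumes "accretive (Suc m) M"
  shows "0 \<le> Re (det M / det (mat_delete M 0 0))"
proof -
  have M: "M \<in> carrier_mat (Suc m) (Suc m)" using assms unfolding accretive_def by simp
  let ?x = "col (adj_mat M) 0"
  have adj: "adj_mat M \<in> carrier_mat (Suc m) (Suc m)" using adj_mat(1)[OF M] .
  have x: "?x \<in> carrier_vec (Suc m)" using adj by (metis carrier_matD(1) col_dim)
  have x0: "?x $ 0 = det (mat_delete M 0 0)"
    using M by (simp add: adj_mat_def cofactor_def)
  have "M *\<^sub>v ?x = col (M * adj_mat M) 0" using M adj by (intro eq_vecI) auto
  also have "\<dots> = det M \<cdot>\<^sub>v unit_vec (Suc m) 0"
    unfolding adj_mat(2)[OF M] by (intro eq_vecI) auto
  finally have Mx: "M *\<^sub>v ?x = det M \<cdot>\<^sub>v unit_vec (Suc m) 0" .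
  have "(M *\<^sub>v ?x) \<bullet>c ?x = det M * cnj (?x $ 0)"
    unfolding Mx using x carrier_vecD[OF x]
    by (subst smult_scalar_prod_distrib[of _ "Suc m"])
      (auto simp: conjugate_complex_def simp del: dim_col)
  then have "0 \<le> Re (det M * cnj (det (mat_delete M 0 0)))"
    using assms x unfolding accretive_def x0 by metis
  then show ?thesis
    by (simp add: Re_complex_div_ge_0)
qed

text \<open>The branch cut of \<open>Arg\<close> meets the closed right half plane only at the
  origin.\<close>

lemma half_plane_not_nonpos:
  assumes "0 \<le> Re z" "z \<noteq> 0"
  shows "z \<notin> \<real>\<^sub>\<le>\<^sub>0"
  using assms by (auto simp: complex_nonpos_Reals_iff complex_eq_iff)

lemma Arg_continuous_half_plane:
  assumes "0 \<le> Re z" "z \<noteq> 0"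
  shows "isCont Arg z"
  by (rule continuous_at_Arg[OF half_plane_not_nonpos[OF assms]])

section \<open>Continuity of the determinant in the entries\<close>

lemma det_continuous_on:
  fixes M :: "real \<Rightarrow> complex mat"
  assumes "\<And>t. M t \<in> carrier_mat m m"
    and "\<And>i j. i < m \<Longrightarrow> j < m \<Longrightarrow> continuous_on S (\<lambda>t. M t $$ (i,j))"
  shows "continuous_on S (\<lambda>t. det (M t))"
proof -
  have "continuous_on S (\<lambda>t. \<Sum>p\<in>{p. p permutes {0..<m}}. signof p * (\<Prod>i=0..<m. M t $$ (i, p i)))"
    using assms(2) by (intro continuous_intros) (auto simp: permutes_in_image)
  then show ?thesis using det_def'[OF assms(1)] by simp
qed

lemma det_tendsto:
  fixes X :: "nat \<Rightarrow> complex mat"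
  assumes "\<And>k. X k \<in> carrier_mat m m" "M \<in> carrier_mat m m"
    and "\<And>i j. i < m \<Longrightarrow> j < m \<Longrightarrow> (\<lambda>k. X k $$ (i,j)) \<longlonglongrightarrow> M $$ (i,j)"
  shows "(\<lambda>k. det (X k)) \<longlonglongrightarrow> det M"
proof -
  have "(\<lambda>k. \<Sum>p\<in>{p. p permutes {0..<m}}. signof p * (\<Prod>i=0..<m. X k $$ (i, p i)))
     \<longlonglongrightarrow> (\<Sum>p\<in>{p. p permutes {0..<m}}. signof p * (\<Prod>i=0..<m. M $$ (i, p i)))"
    using assms(3) by (intro tendsto_intros) (auto simp: permutes_in_image)
  then show ?thesis unfolding det_def'[OF assms(1)] det_def'[OF assms(2)] .
qed

subsection \<open>Continuity of the phase\<close>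

lemma continuous_on_Arg_compose:
  assumes "continuous_on S g" "\<And>t. t \<in> S \<Longrightarrow> g t \<notin> \<real>\<^sub>\<le>\<^sub>0"
  shows "continuous_on S (\<lambda>t. Arg (g t))"
  by (rule continuous_on_compose2[of "g ` S" Arg])
    (use assms in \<open>auto intro!: continuous_at_imp_continuous_on continuous_at_Arg\<close>)

lemma continuous_on_sum_list:
  fixes f :: "'a \<Rightarrow> 'b::topological_space \<Rightarrow> real"
  assumes "\<And>a. a \<in> set as \<Longrightarrow> continuous_on S (f a)"
  shows "continuous_on S (\<lambda>t. \<Sum>a\<leftarrow>as. f a t)"
  using assms by (induction as) (auto intro!: continuous_intros)

lemma accretive_spectrum_not_nonpos:
  assumes "accretive m M" "det M \<noteq> 0" "spectrum_list m M as" "a \<in> set as"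
  shows "a \<notin> \<real>\<^sub>\<le>\<^sub>0"
proof (rule half_plane_not_nonpos)
  show "0 \<le> Re a" using accretive_eigenvalue_Re assms by blast
  show "a \<noteq> 0" using assms det_eq_prod_list[OF assms(3)] by (auto simp: prod_list_zero_iff)
qed

text \<open>Both sides are continuous branches of the argument of the determinant along the segment from
  the identity to \<open>M\<close>, on which the eigenvalues are explicit.\<close>
lemma phase_pivot:
  assumes acc: "accretive (Suc m) M" and dM: "det M \<noteq> 0"
    and sacc: "strictly_accretive m (mat_delete M 0 0)"
  shows "phase M = phase (mat_delete M 0 0) + Arg (det M / det (mat_delete M 0 0))"
proof -
  define D where "D = mat_delete M 0 0"
  define N where "N t = complex_of_real (1 - t) \<cdot>\<^sub>m 1\<^sub>m (Suc m) + complex_of_real t \<cdot>\<^sub>m M" for t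
  define L where "L t = complex_of_real (1 - t) \<cdot>\<^sub>m 1\<^sub>m m + complex_of_real t \<cdot>\<^sub>m D" for t
  have M: "M \<in> carrier_mat (Suc m) (Suc m)" using acc unfolding accretive_def by simp
  have D: "D \<in> carrier_mat m m" using sacc unfolding strictly_accretive_def D_def by simp
  obtain as where as: "spectrum_list (Suc m) M as" using spectrum_list_exists[OF M] by blast
  obtain bs where bs: "spectrum_list m D bs" using spectrum_list_exists[OF D] by blast
  define la where "la t a = complex_of_real (1 - t) + complex_of_real t * a" for t a
  have Nas: "spectrum_list (Suc m) (N t) (map (la t) as)" for t
    unfolding N_def la_def by (rule spectrum_list_affine[OF as])
  have Lbs: "spectrum_list m (L t) (map (la t) bs)" for t
    unfolding L_def la_def by (rule spectrum_list_affine[OF bs])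
  have delN: "mat_delete (N t) 0 0 = L t" for t
    using M D unfolding N_def L_def D_def by (intro eq_matI) (auto simp: mat_delete_def)
  have N1: "N 1 = M" and L1: "L 1 = D"
    unfolding N_def L_def using M D by (auto intro!: eq_matI)
  \<comment> \<open>For \<open>t < 1\<close> strict accretivity gives all three claims; at
    \<open>t = 1\<close> they are the hypotheses on \<open>M\<close> and its block.\<close>
  have N: "accretive (Suc m) (N t)" "det (N t) \<noteq> 0" and L: "strictly_accretive m (L t)"
    if "t \<in> {0..1}" for t
  proof -
    have "accretive (Suc m) (N t) \<and> det (N t) \<noteq> 0 \<and> strictly_accretive m (L t)"
    proof (cases "t = 1")
      case True
      then show ?thesis using N1 L1 acc dM sacc D_def by simp
    next
      case False
      then have "strictly_accretive (Suc m) (N t)"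
        using that strictly_accretive_convex_one[OF acc, of t] unfolding N_def by simp
      then show ?thesis
        using strictly_accretive_imp_accretive strictly_accretive_det_nonzero
          strictly_accretive_mat_delete delN by metis
    qed
    then show "accretive (Suc m) (N t)" "det (N t) \<noteq> 0" "strictly_accretive m (L t)" by auto
  qed
  have Na: "la t a \<notin> \<real>\<^sub>\<le>\<^sub>0" if "t \<in> {0..1}" "a \<in> set as" for t a
    using accretive_spectrum_not_nonpos[OF N[OF that(1)] Nas] that(2) by simp
  have Lb: "la t b \<notin> \<real>\<^sub>\<le>\<^sub>0" if "t \<in> {0..1}" "b \<in> set bs" for t b
    using accretive_spectrum_not_nonpos[OF strictly_accretive_imp_accretive
        strictly_accretive_det_nonzero Lbs, OF L L] that by simp
  have dL: "det (L t) \<noteq> 0" if "t \<in> {0..1}" for t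
    using strictly_accretive_det_nonzero L that by blast
  have s: "det (N t) / det (L t) \<notin> \<real>\<^sub>\<le>\<^sub>0" if "t \<in> {0..1}" for t
    using accretive_pivot_Re[OF N(1)[OF that]] N(2)[OF that] dL[OF that] unfolding delN
    by (intro half_plane_not_nonpos) auto
  define f where "f t = (\<Sum>a\<leftarrow>as. Arg (la t a)) - (\<Sum>b\<leftarrow>bs. Arg (la t b))
      - Arg (det (N t) / det (L t))" for t
  have cla: "continuous_on {0..1} (\<lambda>t. la t a)" for a
    unfolding la_def by (intro continuous_intros)
  have cN: "continuous_on {0..1} (\<lambda>t. det (N t))"
    by (rule det_continuous_on[where m = "Suc m"]) (use M in \<open>auto simp: N_def intro!: continuous_intros\<close>)
  have cL: "continuous_on {0..1} (\<lambda>t. det (L t))"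
    by (rule det_continuous_on[where m = m]) (use D in \<open>auto simp: L_def intro!: continuous_intros\<close>)
  have "f 1 = 0"
  proof (rule continuous_lift_trivial)
    show "continuous_on {0..1} f"
      unfolding f_def using Na Lb s dL
      by (intro continuous_intros continuous_on_sum_list continuous_on_Arg_compose cla cN cL) auto
    show "f 0 = 0"
      \<comment> \<open>At \<open>t = 0\<close> both matrices are identities, so every argument is
        that of 1.\<close>
      unfolding f_def la_def N_def L_def using M D det_affine[OF as, of 1 0] det_affine[OF bs, of 1 0]
      by (simp add: map_replicate_const sum_list_replicate)
    fix t :: real assume t: "t \<in> {0..1}"
    have "0 \<notin> set (map (la t) as)" "0 \<notin> set (map (la t) bs)"
      using Na[OF t] Lb[OF t] by force+
    then have "cis (\<Sum>a\<leftarrow>as. Arg (la t a)) = sgn (det (N t))"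
      "cis (\<Sum>b\<leftarrow>bs. Arg (la t b)) = sgn (det (L t))"
      using cis_sum_list_Arg[of "map (la t) as"] cis_sum_list_Arg[of "map (la t) bs"]
        det_eq_prod_list[OF Nas, of t] det_eq_prod_list[OF Lbs, of t] by (auto simp: o_def)
    moreover have "cis (Arg (det (N t) / det (L t))) = sgn (det (N t)) / sgn (det (L t))"
      using N(2)[OF t] dL[OF t] by (simp add: cis_Arg sgn_divide)
    ultimately show "cis (f t) = 1"
      unfolding f_def using N(2)[OF t] dL[OF t] by (simp add: cis_divide[symmetric] sgn_zero_iff)
  qed
  then show ?thesis
    unfolding f_def N1 L1 la_def D_def[symmetric] phase_eq_sum_list[OF as] phase_eq_sum_list[OF bs] by simp
qed

lemma mat_delete_0_0_tendsto:
  fixes X :: "nat \<Rightarrow> complex mat"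
  assumes "M \<in> carrier_mat (Suc m) (Suc m)" "\<And>k. X k \<in> carrier_mat (Suc m) (Suc m)"
    and "\<And>i j. i < Suc m \<Longrightarrow> j < Suc m \<Longrightarrow> (\<lambda>k. X k $$ (i,j)) \<longlonglongrightarrow> M $$ (i,j)"
    and "i < m" "j < m"
  shows "(\<lambda>k. mat_delete (X k) 0 0 $$ (i,j)) \<longlonglongrightarrow> mat_delete M 0 0 $$ (i,j)"
  using assms(3)[of "Suc i" "Suc j"] assms(4,5)
  by (simp add: mat_delete_0_0_index[OF assms(1)] mat_delete_0_0_index[OF assms(2)])

text \<open>Convergence passes from the block to the whole matrix because the quotient of
  determinants converges to a nonzero point of the closed right half plane, where \<open>Arg\<close>
  is continuous. This replaces any appeal to continuity of eigenvalues.\<close>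

lemma phase_tendsto_pivot:
  assumes acc: "accretive (Suc m) M" "det M \<noteq> 0" "strictly_accretive m (mat_delete M 0 0)"
    and accX: "\<And>k. accretive (Suc m) (X k)" "\<And>k. det (X k) \<noteq> 0"
      "\<And>k. strictly_accretive m (mat_delete (X k) 0 0)"
    and lim: "\<And>i j. i < Suc m \<Longrightarrow> j < Suc m \<Longrightarrow> (\<lambda>k. X k $$ (i,j)) \<longlonglongrightarrow> M $$ (i,j)"
    and del: "(\<lambda>k. phase (mat_delete (X k) 0 0)) \<longlonglongrightarrow> phase (mat_delete M 0 0)"
  shows "(\<lambda>k. phase (X k)) \<longlonglongrightarrow> phase M"
proof -
  have car: "M \<in> carrier_mat (Suc m) (Suc m)" "X k \<in> carrier_mat (Suc m) (Suc m)"
    "mat_delete M 0 0 \<in> carrier_mat m m" "mat_delete (X k) 0 0 \<in> carrier_mat m m" for k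
    using acc accX unfolding accretive_def strictly_accretive_def by auto
  have d: "det (mat_delete M 0 0) \<noteq> 0" using strictly_accretive_det_nonzero acc(3) by blast
  have "(\<lambda>k. det (X k)) \<longlonglongrightarrow> det M" using det_tendsto[OF car(2,1) lim] .
  moreover have "(\<lambda>k. det (mat_delete (X k) 0 0)) \<longlonglongrightarrow> det (mat_delete M 0 0)"
    using det_tendsto[OF car(4,3) mat_delete_0_0_tendsto[OF car(1,2) lim]] .
  ultimately have "(\<lambda>k. det (X k) / det (mat_delete (X k) 0 0)) \<longlonglongrightarrow> det M / det (mat_delete M 0 0)"
    using d by (intro tendsto_divide)
  moreover have "isCont Arg (det M / det (mat_delete M 0 0))"
    using accretive_pivot_Re[OF acc(1)] acc(2) d by (intro Arg_continuous_half_plane) auto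
  ultimately have "(\<lambda>k. Arg (det (X k) / det (mat_delete (X k) 0 0))) \<longlonglongrightarrow> Arg (det M / det (mat_delete M 0 0))"
    by (rule isCont_tendsto_compose[rotated])
  with del show ?thesis
    unfolding phase_pivot[OF acc] phase_pivot[OF accX] by (rule tendsto_add)
qed

lemma phase_dim_0:
  assumes "M \<in> carrier_mat 0 0"
  shows "phase M = 0"
proof -
  obtain as where "spectrum_list 0 M as" using spectrum_list_exists[OF assms] by blast
  then show ?thesis using phase_eq_sum_list[of 0 M as] unfolding spectrum_list_def by simp
qed

text \<open>Induction on the dimension: strict accretivity is inherited by the block left after
  removing row and column 0.\<close>

lemma phase_tendsto_strict:
  assumes "strictly_accretive m M" "\<And>k. strictly_accretive m (X k)"
    and "\<And>i j. i < m \<Longrightarrow> j < m \<Longrightarrow> (\<lambda>k. X k $$ (i,j)) \<longlonglongrightarrow> M $$ (i,j)"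
  shows "(\<lambda>k. phase (X k)) \<longlonglongrightarrow> phase M"
  using assms
proof (induction m arbitrary: M X)
  case 0
  then show ?case unfolding strictly_accretive_def by (simp add: phase_dim_0)
next
  case (Suc m)
  have car: "M \<in> carrier_mat (Suc m) (Suc m)" "X k \<in> carrier_mat (Suc m) (Suc m)" for k
    using Suc.prems unfolding strictly_accretive_def by auto
  have del: "strictly_accretive m (mat_delete M 0 0)" "strictly_accretive m (mat_delete (X k) 0 0)" for k
    using Suc.prems strictly_accretive_mat_delete by blast+
  then have lim_del: "(\<lambda>k. phase (mat_delete (X k) 0 0)) \<longlonglongrightarrow> phase (mat_delete M 0 0)"
    by (intro Suc.IH mat_delete_0_0_tendsto[OF car Suc.prems(3)])
  show ?case
    by (rule phase_tendsto_pivot[OF strictly_accretive_imp_accretive[OF Suc.prems(1)]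
        strictly_accretive_det_nonzero[OF Suc.prems(1)] del(1)
        strictly_accretive_imp_accretive[OF Suc.prems(2)]
        strictly_accretive_det_nonzero[OF Suc.prems(2)] del(2) _ lim_del]) (rule Suc.prems(3))
qed

text \<open>Here only the block is strictly accretive, the whole matrix being accretive and
  invertible; this is the situation of \<open>In_plus_iA\<close> off \<open>\<S>\<close>.\<close>

lemma phase_tendsto:
  assumes acc: "accretive (Suc m) M" "det M \<noteq> 0" "strictly_accretive m (mat_delete M 0 0)"
    and accX: "\<And>k. accretive (Suc m) (X k)" "\<And>k. det (X k) \<noteq> 0"
      "\<And>k. strictly_accretive m (mat_delete (X k) 0 0)"
    and lim: "\<And>i j. i < Suc m \<Longrightarrow> j < Suc m \<Longrightarrow> (\<lambda>k. X k $$ (i,j)) \<longlonglongrightarrow> M $$ (i,j)"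
  shows "(\<lambda>k. phase (X k)) \<longlonglongrightarrow> phase M"
proof -
  have car: "M \<in> carrier_mat (Suc m) (Suc m)" "X k \<in> carrier_mat (Suc m) (Suc m)" for k
    using acc accX unfolding accretive_def by auto
  have lim_del: "(\<lambda>k. phase (mat_delete (X k) 0 0)) \<longlonglongrightarrow> phase (mat_delete M 0 0)"
    using phase_tendsto_strict[OF acc(3) accX(3) mat_delete_0_0_tendsto[OF car lim]] .
  show ?thesis by (rule phase_tendsto_pivot[OF acc accX _ lim_del]) (rule lim)
qed

subsection \<open>Monotonicity of the phase\<close>

abbreviation complexify :: "real mat \<Rightarrow> complex mat" where
  "complexify \<equiv> map_mat complex_of_real"

lemma sym_mats_index:
  assumes "R \<in> sym_mats m" "i < m" "j < m"
  shows "R $$ (i,j) = R $$ (j,i)"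
proof -
  have R: "R \<in> carrier_mat m m" and t: "transpose_mat R = R" using assms unfolding sym_mats_def by auto
  have "R $$ (j,i) = transpose_mat R $$ (i,j)" using R assms by simp
  then show ?thesis unfolding t by simp
qed

lemma sym_mats_quadratic_form_Im:
  assumes R: "R \<in> sym_mats m" and v: "v \<in> carrier_vec m"
  shows "Im ((complexify R *\<^sub>v v) \<bullet>c v) = 0"
proof -
  have C: "complexify R \<in> carrier_mat m m" using R unfolding sym_mats_def by simp
  have idx: "complexify R $$ (i,j) = complex_of_real (R $$ (i,j))" if "i < m" "j < m" for i j
    using R that unfolding sym_mats_def by auto
  let ?q = "\<Sum>i<m. \<Sum>j<m. complex_of_real (R $$ (i,j)) * v $ j * cnj (v $ i)"
  have eq: "(complexify R *\<^sub>v v) \<bullet>c v = ?q"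
    unfolding quadratic_form_eq[OF C v] using idx by (intro sum.cong) auto
  have "cnj ?q = (\<Sum>i<m. \<Sum>j<m. complex_of_real (R $$ (i,j)) * cnj (v $ j) * v $ i)"
    by simp
  also have "\<dots> = (\<Sum>j<m. \<Sum>i<m. complex_of_real (R $$ (i,j)) * cnj (v $ j) * v $ i)"
    by (rule sum.swap)
  also have "\<dots> = ?q"
    using sym_mats_index[OF R] by (intro sum.cong) (auto simp: mult_ac)
  finally have "cnj ?q = ?q" .
  then have "?q \<in> \<real>" by (simp only: Reals_cnj_iff)
  then show ?thesis unfolding eq by (simp only: complex_is_Real_iff)
qed

text \<open>Writing \<open>v = x + \<i> y\<close>, the real part of the form is the sum of the real
  forms at \<open>x\<close> and \<open>y\<close>; the cross terms are imaginary.\<close>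

lemma psd_mats_quadratic_form_Re:
  assumes P: "P \<in> psd_mats m" and v: "v \<in> carrier_vec m"
  shows "0 \<le> Re ((complexify P *\<^sub>v v) \<bullet>c v)"
proof -
  have Pc: "P \<in> carrier_mat m m" and pos: "\<And>w. w \<in> carrier_vec m \<Longrightarrow> 0 \<le> w \<bullet> (P *\<^sub>v w)"
    using P unfolding psd_mats_def sym_mats_def by auto
  have C: "complexify P \<in> carrier_mat m m" using Pc by simp
  have qf: "w \<bullet> (P *\<^sub>v w) = (\<Sum>i<m. \<Sum>j<m. w $ i * P $$ (i,j) * w $ j)" if "w \<in> carrier_vec m" for w
    using that Pc by (auto simp: scalar_prod_def mult_mat_vec_def atLeast0LessThan
      sum_distrib_left mult_ac intro!: sum.cong)
  have w: "map_vec Re v \<in> carrier_vec m" "map_vec Im v \<in> carrier_vec m" using v by auto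
  have "Re ((complexify P *\<^sub>v v) \<bullet>c v)
     = map_vec Re v \<bullet> (P *\<^sub>v map_vec Re v) + map_vec Im v \<bullet> (P *\<^sub>v map_vec Im v)"
    unfolding quadratic_form_eq[OF C v] qf[OF w(1)] qf[OF w(2)] sum.distrib[symmetric] Re_sum
    using v Pc by (intro sum.cong refl) (auto simp: algebra_simps)
  then show ?thesis using pos[OF w(1)] pos[OF w(2)] by simp
qed

text \<open>The form of \<open>R\<close> is real, so \<open>\<i> R\<close> contributes only to the
  imaginary part. Accretivity of \<open>I\<^sub>n + \<i> A\<close> and its variants is therefore
  decided by the weight alone.\<close>

lemma quadratic_form_add_imag:
  assumes M: "M \<in> carrier_mat m m" and R: "R \<in> sym_mats m" and v: "v \<in> carrier_vec m"
  shows "Re (((M + \<i> \<cdot>\<^sub>m complexify R) *\<^sub>v v) \<bullet>c v) = Re ((M *\<^sub>v v) \<bullet>c v)"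
proof -
  have C: "complexify R \<in> carrier_mat m m" using R unfolding sym_mats_def by simp
  have "(M + \<i> \<cdot>\<^sub>m complexify R) *\<^sub>v v = M *\<^sub>v v + \<i> \<cdot>\<^sub>v (complexify R *\<^sub>v v)"
    using M C v by (intro eq_vecI) (auto simp: add_mult_distrib_mat_vec[of _ m m])
  then have "((M + \<i> \<cdot>\<^sub>m complexify R) *\<^sub>v v) \<bullet>c v
      = (M *\<^sub>v v) \<bullet>c v + \<i> * ((complexify R *\<^sub>v v) \<bullet>c v)"
    using M C v by (simp add: add_scalar_prod_distrib[of _ m])
  then show ?thesis using sym_mats_quadratic_form_Im[OF R v] by simp
qed

lemma strictly_accretive_add_imag:
  assumes "strictly_accretive m M" "R \<in> sym_mats m"
  shows "strictly_accretive m (M + \<i> \<cdot>\<^sub>m complexify R)"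
proof -
  have M: "M \<in> carrier_mat m m" using assms unfolding strictly_accretive_def by simp
  have "complexify R \<in> carrier_mat m m" using assms unfolding sym_mats_def by simp
  then show ?thesis
    using M assms quadratic_form_add_imag[OF M assms(2)] unfolding strictly_accretive_def by simp
qed

lemma accretive_add_imag:
  assumes "accretive m M" "R \<in> sym_mats m"
  shows "accretive m (M + \<i> \<cdot>\<^sub>m complexify R)"
proof -
  have M: "M \<in> carrier_mat m m" using assms unfolding accretive_def by simp
  have "complexify R \<in> carrier_mat m m" using assms unfolding sym_mats_def by simp
  then show ?thesis
    using M assms quadratic_form_add_imag[OF M assms(2)] unfolding accretive_def by simp
qed

text \<open>An eigenvalue \<open>l\<close> of \<open>M\<inverse> P\<close> satisfies \<open>y* P y = l (y* M y)\<close> for some \<open>y \<noteq> 0\<close>.\<close>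
lemma eigenvalue_inverse_psd:
  assumes sacc: "strictly_accretive m M" and P: "P \<in> psd_mats m"
    and N: "N \<in> carrier_mat m m" "M * N = 1\<^sub>m m"
    and sp: "spectrum_list m (N * complexify P) ls" and l: "l \<in> set ls"
  shows "0 < Re l \<or> l = 0"
proof -
  have M: "M \<in> carrier_mat m m" using sacc unfolding strictly_accretive_def by simp
  have Ps: "P \<in> sym_mats m" and Pc: "complexify P \<in> carrier_mat m m"
    using P unfolding psd_mats_def sym_mats_def by auto
  obtain y where y: "y \<in> carrier_vec m" "y \<noteq> 0\<^sub>v m" and ev: "(N * complexify P) *\<^sub>v y = l \<cdot>\<^sub>v y"
    using spectrum_list_eigenvector[OF sp l] by blast
  have "complexify P *\<^sub>v y = (M * N) *\<^sub>v (complexify P *\<^sub>v y)" unfolding N(2) using Pc y by simp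
  also have "\<dots> = M *\<^sub>v (N *\<^sub>v (complexify P *\<^sub>v y))"
    by (rule assoc_mult_mat_vec[OF M N(1)]) (use Pc y in auto)
  also have "N *\<^sub>v (complexify P *\<^sub>v y) = (N * complexify P) *\<^sub>v y"
    by (rule assoc_mult_mat_vec[OF N(1) Pc y(1), symmetric])
  also have "M *\<^sub>v ((N * complexify P) *\<^sub>v y) = l \<cdot>\<^sub>v (M *\<^sub>v y)" unfolding ev using M y by (simp add: mult_mat_vec[of _ m m])
  finally have "(complexify P *\<^sub>v y) \<bullet>c y = l * ((M *\<^sub>v y) \<bullet>c y)"
    using M y by simp
  moreover define p where "p = Re ((complexify P *\<^sub>v y) \<bullet>c y)"
  moreover define q where "q = (M *\<^sub>v y) \<bullet>c y"
  ultimately have lq: "complex_of_real p = l * q"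
    using sym_mats_quadratic_form_Im[OF Ps y(1)] by (simp add: complex_eq_iff)
  have q: "0 < Re q" using sacc y unfolding strictly_accretive_def q_def by simp
  have p: "0 \<le> p" using psd_mats_quadratic_form_Re[OF P y(1)] unfolding p_def .
  have "q \<noteq> 0" using q by auto
  then have "l = complex_of_real p / q" using lq by (simp add: field_simps)
  \<comment> \<open>Thus \<open>l\<close> is a nonnegative multiple of \<open>cnj q\<close>, which
    lies in the open right half plane.\<close>
  then have lp: "l = complex_of_real (p / (cmod q)\<^sup>2) * cnj q"
    using \<open>q \<noteq> 0\<close> by (simp add: complex_div_cnj[of "complex_of_real p" q] field_simps)
  show ?thesis
  proof (cases "p = 0")
    case True
    then show ?thesis using lp by simp
  next
    case False
    then have "0 < p / (cmod q)\<^sup>2" using p \<open>q \<noteq> 0\<close> by simp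
    then have "0 < Re l" 
      unfolding lp using mult_pos_pos[OF _ q, of "p / (cmod q)\<^sup>2"]
      by (simp del: of_real_divide of_real_power)
    then show ?thesis by simp
  qed
qed

lemma psd_mats_smult:
  assumes "P \<in> psd_mats m" "0 \<le> t"
  shows "t \<cdot>\<^sub>m P \<in> psd_mats m"
  unfolding psd_mats_def sym_mats_def
proof (intro CollectI conjI ballI)
  have P: "P \<in> carrier_mat m m" "transpose_mat P = P"
    using assms unfolding psd_mats_def sym_mats_def by auto
  then show "t \<cdot>\<^sub>m P \<in> carrier_mat m m" by simp
  show "transpose_mat (t \<cdot>\<^sub>m P) = t \<cdot>\<^sub>m P" 
    using P sym_mats_index[of P m] unfolding sym_mats_def by (intro eq_matI) auto
  fix v :: "real vec" assume v: "v \<in> carrier_vec m"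
  have "(t \<cdot>\<^sub>m P) *\<^sub>v v = t \<cdot>\<^sub>v (P *\<^sub>v v)" using P v by (intro eq_vecI) auto
  then have "v \<bullet> ((t \<cdot>\<^sub>m P) *\<^sub>v v) = t * (v \<bullet> (P *\<^sub>v v))" using P v by simp
  then show "0 \<le> v \<bullet> ((t \<cdot>\<^sub>m P) *\<^sub>v v)" using assms v unfolding psd_mats_def by simp
qed

text \<open>The increment of the phase along \<open>M + \<i> t P\<close> is the total argument of the numbers
  \<open>1 + \<i> t l\<close> with \<open>l\<close> an eigenvalue of \<open>M\<inverse> P\<close>, which stay in the closed upper half plane.\<close>
lemma phase_mono:
  assumes sacc: "strictly_accretive m M" and P: "P \<in> psd_mats m"
  shows "phase M \<le> phase (M + \<i> \<cdot>\<^sub>m complexify P)"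
proof -
  have M: "M \<in> carrier_mat m m" using sacc unfolding strictly_accretive_def by simp
  have Pc: "complexify P \<in> carrier_mat m m" and Pr: "P \<in> carrier_mat m m"
    using P unfolding psd_mats_def sym_mats_def by auto
  have dM: "det M \<noteq> 0" by (rule strictly_accretive_det_nonzero[OF sacc])
  obtain N where N: "N \<in> carrier_mat m m" "M * N = 1\<^sub>m m" "N * M = 1\<^sub>m m"
    using det_non_zero_imp_unit[OF M dM, of "()"] unfolding Units_def ring_mat_def by auto
  obtain ls where ls: "spectrum_list m (N * complexify P) ls"
    using spectrum_list_exists[of "N * complexify P" m] N Pc by auto
  note lpos = eigenvalue_inverse_psd[OF sacc P N(1,2) ls]
  define X where "X t = M + \<i> \<cdot>\<^sub>m complexify (t \<cdot>\<^sub>m P)" for t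
  have X: "strictly_accretive m (X t)" if "0 \<le> t" for t
    unfolding X_def using strictly_accretive_add_imag[OF sacc] psd_mats_smult[OF P that]
    unfolding psd_mats_def by blast
  have Xidx: "X t $$ (i,j) = M $$ (i,j) + \<i> * (complex_of_real t * complex_of_real (P $$ (i,j)))"
    if "i < m" "j < m" for t i j using that M Pr unfolding X_def by simp
  \<comment> \<open>Factoring out \<open>M\<close> leaves \<open>I + \<i> t M\<inverse> P\<close>,
    an affine image of a matrix with eigenvalues \<open>ls\<close>.\<close>
  have Xdet: "det (X t) = det M * (\<Prod>l\<leftarrow>ls. 1 + \<i> * complex_of_real t * l)" for t
  proof -
    have "X t = M * (1 \<cdot>\<^sub>m 1\<^sub>m m + (\<i> * complex_of_real t) \<cdot>\<^sub>m (N * complexify P))"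
    proof -
      have one: "1 \<cdot>\<^sub>m M = M" by (intro eq_matI) auto
      have "M * (1 \<cdot>\<^sub>m 1\<^sub>m m + (\<i> * complex_of_real t) \<cdot>\<^sub>m (N * complexify P))
         = M * (1 \<cdot>\<^sub>m 1\<^sub>m m) + M * ((\<i> * complex_of_real t) \<cdot>\<^sub>m (N * complexify P))"
        using M N Pc by (intro mult_add_distrib_mat[of _ m m _ m]) auto
      also have "\<dots> = M + (\<i> * complex_of_real t) \<cdot>\<^sub>m (M * (N * complexify P))"
        using M N Pc one by (simp add: mult_smult_distrib[of _ m m _ m])
      also have "M * (N * complexify P) = complexify P"
        using M N Pc by (simp add: assoc_mult_mat[of _ m m _ m _ m, symmetric])
      also have "M + (\<i> * complex_of_real t) \<cdot>\<^sub>m complexify P = X t"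
        unfolding X_def using M Pr by (intro eq_matI) auto
      finally show ?thesis ..
    qed
    then have "det (X t) = det M * det (1 \<cdot>\<^sub>m 1\<^sub>m m + (\<i> * complex_of_real t) \<cdot>\<^sub>m (N * complexify P))"
      using M N Pc by (simp add: det_mult[of _ m])
    then show ?thesis using det_affine[OF ls] by simp
  qed
  \<comment> \<open>The imaginary part is \<open>t * Re l\<close>, which is nonnegative; where it
    vanishes, \<open>t = 0\<close> or \<open>l = 0\<close> and the number is 1.\<close>
  have nn: "1 + \<i> * complex_of_real t * l \<notin> \<real>\<^sub>\<le>\<^sub>0" "0 \<le> Arg (1 + \<i> * complex_of_real t * l)"
    if "0 \<le> t" "l \<in> set ls" for t l
    using lpos[OF that(2)] that(1)
    by (auto simp: complex_nonpos_Reals_iff Arg_less_0)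
  define f where "f t = phase (X t) - phase M - (\<Sum>l\<leftarrow>ls. Arg (1 + \<i> * complex_of_real t * l))" for t
  have "f 1 = 0"
  proof (rule continuous_lift_trivial)
    have "continuous_on {0..1} (\<lambda>t. phase (X t))"
      unfolding continuous_on_sequentially
    proof (intro allI ballI impI, elim conjE)
      fix u and t :: real assume t: "t \<in> {0..1}" and u: "\<forall>k. u k \<in> {0..1}" "u \<longlonglongrightarrow> t"
      have "(\<lambda>k. phase (X (u k))) \<longlonglongrightarrow> phase (X t)"
      proof (rule phase_tendsto_strict)
        show "strictly_accretive m (X t)" "\<And>k. strictly_accretive m (X (u k))" using t u X by auto
        show "(\<lambda>k. X (u k) $$ (i,j)) \<longlonglongrightarrow> X t $$ (i,j)" if "i < m" "j < m" for i j
          unfolding Xidx[OF that] using u(2) by (intro tendsto_intros)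
      qed
      then show "((\<lambda>t. phase (X t)) \<circ> u) \<longlonglongrightarrow> phase (X t)" by (simp add: o_def)
    qed
    then show "continuous_on {0..1} f"
      unfolding f_def using nn(1)
      by (intro continuous_on_diff continuous_on_sum_list continuous_on_Arg_compose)
        (auto intro!: continuous_intros)
    have "X 0 = M" unfolding X_def using M Pr by (intro eq_matI) auto
    then show "f 0 = 0" unfolding f_def by (simp add: map_replicate_const sum_list_replicate)
    fix t :: real assume t: "t \<in> {0..1}"
    have "X t \<in> carrier_mat m m" using X t unfolding strictly_accretive_def by simp
    then obtain as where as: "spectrum_list m (X t) as" using spectrum_list_exists by blast
    obtain bs where bs: "spectrum_list m M bs" using spectrum_list_exists[OF M] by blast
    have dX: "det (X t) \<noteq> 0" using strictly_accretive_det_nonzero X t by auto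
    have "0 \<notin> set as" "0 \<notin> set bs"
      using dX dM det_eq_prod_list[OF as] det_eq_prod_list[OF bs] by (auto simp: prod_list_zero_iff)
    then have "cis (phase (X t)) = sgn (det (X t))" "cis (phase M) = sgn (det M)"
      using cis_sum_list_Arg phase_eq_sum_list as bs det_eq_prod_list[OF as] det_eq_prod_list[OF bs]
      by metis+
    moreover have "0 \<notin> set (map (\<lambda>l. 1 + \<i> * complex_of_real t * l) ls)"
      using nn(1) t by force
    then have "cis (\<Sum>l\<leftarrow>ls. Arg (1 + \<i> * complex_of_real t * l))
        = sgn (\<Prod>l\<leftarrow>ls. 1 + \<i> * complex_of_real t * l)"
      using cis_sum_list_Arg by (fastforce simp: o_def)
    ultimately show "cis (f t) = 1"
      unfolding f_def using dX Xdet[of t]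
      by (simp add: cis_divide[symmetric] sgn_mult sgn_zero_iff)
  qed
  moreover have "X 1 = M + \<i> \<cdot>\<^sub>m complexify P" unfolding X_def using M Pr by (intro eq_matI) auto
  moreover have "0 \<le> (\<Sum>l\<leftarrow>ls. Arg (1 + \<i> * complex_of_real 1 * l))"
    using nn(2)[of 1] by (intro sum_list_nonneg) auto
  ultimately show ?thesis unfolding f_def by simp
qed

subsection \<open>The pivot formula for the angle\<close>

lemma map_poly_of_real_linear_factors:
  "map_poly complex_of_real (\<Prod>r\<leftarrow>rs. [:- r, 1:]) = (\<Prod>r\<leftarrow>map complex_of_real rs. [:- r, 1:])"
proof -
  interpret h: map_poly_inj_idom_hom complex_of_real ..
  show ?thesis by (simp add: h.hom_prod_list o_def)
qed

lemma spectrum_list_complexify: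
  assumes R: "R \<in> carrier_mat m m" and len: "length rs = m"
  shows "spectrum_list m (complexify R) (map complex_of_real rs) \<longleftrightarrow> spectrum_list m R rs"
proof -
  interpret h: map_poly_inj_idom_hom complex_of_real ..
  have "char_poly (complexify R) = map_poly complex_of_real (char_poly R)"
    by (rule of_real_hom.char_poly_hom[OF R])
  then have "char_poly (complexify R) = (\<Prod>r\<leftarrow>map complex_of_real rs. [:- r, 1:])
     \<longleftrightarrow> char_poly R = (\<Prod>r\<leftarrow>rs. [:- r, 1:])"
    unfolding map_poly_of_real_linear_factors[symmetric] by simp
  then show ?thesis using assms unfolding spectrum_list_def by simp
qed

text \<open>The complex eigenvalues are real because the form is real on eigenvectors. The
  factorization then descends to the reals, since extending scalars is injective on
  polynomials.\<close>

lemma sym_mats_spectrum_list: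
  assumes R: "R \<in> sym_mats m"
  shows "\<exists>rs. spectrum_list m R rs"
proof -
  have Rc: "R \<in> carrier_mat m m" and C: "complexify R \<in> carrier_mat m m"
    using R unfolding sym_mats_def by auto
  obtain as where as: "spectrum_list m (complexify R) as" using spectrum_list_exists[OF C] by blast
  have real: "complex_of_real (Re a) = a" if "a \<in> set as" for a
  proof -
    obtain v where v: "v \<in> carrier_vec m" "v \<noteq> 0\<^sub>v m" "complexify R *\<^sub>v v = a \<cdot>\<^sub>v v"
      using spectrum_list_eigenvector[OF as \<open>a \<in> set as\<close>] by blast
    have "(complexify R *\<^sub>v v) \<bullet>c v = a * (v \<bullet>c v)" unfolding v(3) using v(1) by simp
    then have "Im a * (\<Sum>i<m. (cmod (v $ i))\<^sup>2) = 0"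
      using sym_mats_quadratic_form_Im[OF R v(1)] unfolding cscalar_prod_self[OF v(1)] by simp
    then have "Im a = 0" using cscalar_prod_self_pos[OF v(1,2)] by simp
    then show ?thesis by (simp add: complex_eq_iff)
  qed
  have "map complex_of_real (map Re as) = as" using real by (simp add: map_idI)
  moreover have "length (map Re as) = m" using as unfolding spectrum_list_def by simp
  ultimately have "spectrum_list m R (map Re as)"
    using spectrum_list_complexify[OF Rc, of "map Re as"] as by simp
  then show ?thesis ..
qed

lemma spectrum_list_one_plus_imag:
  assumes "spectrum_list m R rs"
  shows "spectrum_list m (1\<^sub>m m + \<i> \<cdot>\<^sub>m complexify R) (map (\<lambda>r. 1 + \<i> * complex_of_real r) rs)"
proof -
  have "R \<in> carrier_mat m m" "length rs = m" using assms unfolding spectrum_list_def by auto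
  then have "spectrum_list m (complexify R) (map complex_of_real rs)"
    using spectrum_list_complexify assms by blast
  moreover have "1 \<cdot>\<^sub>m 1\<^sub>m m = (1\<^sub>m m :: complex mat)" by (intro eq_matI) auto
  ultimately show ?thesis 
    using spectrum_list_affine[of m "complexify R" "map complex_of_real rs" 1 \<i>] by (simp add: o_def)
qed

text \<open>Since \<open>Arg (1 + \<i> r) = arctan r\<close>, the phase of the block is the trace of
  the arctangent in the definition of the angle on \<open>\<S>\<close>.\<close>

lemma phase_one_plus_imag:
  assumes "spectrum_list m R rs"
  shows "phase (1\<^sub>m m + \<i> \<cdot>\<^sub>m complexify R) = (\<Sum>r\<leftarrow>rs. arctan r)"
  unfolding phase_eq_sum_list[OF spectrum_list_one_plus_imag[OF assms]]
  by (simp add: o_def arg_conv_arctan)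

lemma Arg_half_plane_bound:
  assumes "0 \<le> Re z" "z \<noteq> 0"
  shows "\<bar>Arg z\<bar> \<le> pi / 2"
  using Re_Ln_pos_le[OF assms(2)] assms by (simp add: Arg_eq_Im_Ln)

text \<open>The value \<open>e = 0\<close> gives \<open>I\<^sub>n\<close>; a positive
  \<open>e\<close> is the perturbation that makes the weight strictly accretive.\<close>

definition weight_mat :: "nat \<Rightarrow> real \<Rightarrow> complex mat" where
  "weight_mat n e =
     mat (Suc n) (Suc n) (\<lambda>(i,j). if i = j then (if i = 0 then complex_of_real e else 1) else 0)"

lemma weight_mat_carrier [simp]: "weight_mat n e \<in> carrier_mat (Suc n) (Suc n)"
  unfolding weight_mat_def by simp

lemma weight_mat_quadratic_form:
  assumes "v \<in> carrier_vec (Suc n)"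
  shows "Re ((weight_mat n e *\<^sub>v v) \<bullet>c v) = e * (cmod (v $ 0))\<^sup>2 + (\<Sum>i<n. (cmod (v $ Suc i))\<^sup>2)"
proof -
  have "(weight_mat n e *\<^sub>v v) \<bullet>c v
     = (\<Sum>i<Suc n. (if i = 0 then complex_of_real e else 1) * v $ i * cnj (v $ i))"
    unfolding quadratic_form_eq[OF weight_mat_carrier assms]
  proof (rule sum.cong[OF refl])
    fix i assume "i \<in> {..<Suc n}"
    then have "(\<Sum>j<Suc n. weight_mat n e $$ (i, j) * v $ j * cnj (v $ i))
       = (\<Sum>j<Suc n. if i = j then (if i = 0 then complex_of_real e else 1) * v $ i * cnj (v $ i) else 0)"
      unfolding weight_mat_def by (intro sum.cong) auto
    then show "(\<Sum>j<Suc n. weight_mat n e $$ (i, j) * v $ j * cnj (v $ i))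
       = (if i = 0 then complex_of_real e else 1) * v $ i * cnj (v $ i)"
      using \<open>i \<in> {..<Suc n}\<close> by (simp del: sum.lessThan_Suc)
  qed
  also have "\<dots> = complex_of_real (e * (cmod (v $ 0))\<^sup>2 + (\<Sum>i<n. (cmod (v $ Suc i))\<^sup>2))"
    by (simp add: sum.lessThan_Suc_shift complex_norm_square[symmetric] mult.assoc del: sum.lessThan_Suc)
  finally show ?thesis by simp
qed

lemma weight_mat_accretive:
  assumes "0 \<le> e"
  shows "accretive (Suc n) (weight_mat n e)"
  unfolding accretive_def using assms by (auto simp: weight_mat_quadratic_form intro!: add_nonneg_nonneg sum_nonneg)

lemma weight_mat_strictly_accretive:
  assumes "0 < e"
  shows "strictly_accretive (Suc n) (weight_mat n e)"
  unfolding strictly_accretive_def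
proof (intro conjI ballI impI)
  fix v :: "complex vec" assume v: "v \<in> carrier_vec (Suc n)" "v \<noteq> 0\<^sub>v (Suc n)"
  have pos: "0 \<le> (\<Sum>i<n. (cmod (v $ Suc i))\<^sup>2)" by (intro sum_nonneg) auto
  have "0 < (cmod (v $ 0))\<^sup>2 + (\<Sum>i<n. (cmod (v $ Suc i))\<^sup>2)"
    using cscalar_prod_self_pos[OF v] by (simp add: sum.lessThan_Suc_shift del: sum.lessThan_Suc)
  then show "0 < Re ((weight_mat n e *\<^sub>v v) \<bullet>c v)"
    unfolding weight_mat_quadratic_form[OF v(1)] using assms pos
    by (cases "v $ 0 = 0") (auto simp: add_pos_nonneg)
qed simp

lemma one_mat_strictly_accretive: "strictly_accretive m (1\<^sub>m m)"
  unfolding strictly_accretive_def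
proof (intro conjI ballI impI)
  fix v :: "complex vec" assume v: "v \<in> carrier_vec m" "v \<noteq> 0\<^sub>v m"
  have "(1\<^sub>m m *\<^sub>v v) \<bullet>c v = v \<bullet>c v" using v by simp
  then show "0 < Re ((1\<^sub>m m *\<^sub>v v) \<bullet>c v)"
    using cscalar_prod_self_pos[OF v] unfolding cscalar_prod_self[OF v(1)]
    by (simp only: Re_complex_of_real)
qed simp

abbreviation weighted_mat :: "nat \<Rightarrow> real \<Rightarrow> real mat \<Rightarrow> complex mat" where
  "weighted_mat n e A \<equiv> weight_mat n e + \<i> \<cdot>\<^sub>m complexify A"

abbreviation block_mat :: "nat \<Rightarrow> real mat \<Rightarrow> complex mat" where
  "block_mat n A \<equiv> 1\<^sub>m n + \<i> \<cdot>\<^sub>m complexify (Aplus n A)"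

lemma sym_mats_carrier: "A \<in> sym_mats m \<Longrightarrow> A \<in> carrier_mat m m"
  unfolding sym_mats_def by simp

lemma In_plus_iA_eq_weighted:
  assumes "A \<in> sym_mats (Suc n)"
  shows "In_plus_iA n A = weighted_mat n 0 A"
  using sym_mats_carrier[OF assms] unfolding In_plus_iA_def weight_mat_def
  by (intro eq_matI) auto

lemma mat_delete_weighted:
  assumes "A \<in> sym_mats (Suc n)"
  shows "mat_delete (weighted_mat n e A) 0 0 = block_mat n A"
  using sym_mats_carrier[OF assms] unfolding weight_mat_def Aplus_def
  by (intro eq_matI) (auto simp: mat_delete_def)

lemma Aplus_sym:
  assumes "A \<in> sym_mats (Suc n)"
  shows "Aplus n A \<in> sym_mats n"
  using sym_mats_index[OF assms] unfolding sym_mats_def Aplus_def by auto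

lemma block_mat_strictly_accretive:
  assumes "A \<in> sym_mats (Suc n)"
  shows "strictly_accretive n (block_mat n A)"
  by (rule strictly_accretive_add_imag[OF one_mat_strictly_accretive Aplus_sym[OF assms]])

lemma weighted_mat_accretive:
  assumes "A \<in> sym_mats (Suc n)" "0 \<le> e"
  shows "accretive (Suc n) (weighted_mat n e A)"
  by (rule accretive_add_imag[OF weight_mat_accretive[OF assms(2)] assms(1)])

text \<open>The real part of the form is the squared norm of the coordinates other than 0. An
  imaginary eigenvalue thus forces the eigenvector onto the axis of coordinate 0, and column 0 of
  the matrix can be read off.\<close>

lemma In_plus_iA_imaginary_eigenvalue:
  assumes A: "A \<in> sym_mats (Suc n)" and v: "v \<in> carrier_vec (Suc n)" "v \<noteq> 0\<^sub>v (Suc n)"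
    and ev: "In_plus_iA n A *\<^sub>v v = l \<cdot>\<^sub>v v" and l: "Re l = 0"
  shows "i < n \<Longrightarrow> A $$ (Suc i, 0) = 0" "l = \<i> * complex_of_real (A $$ (0,0))"
proof -
  have B: "In_plus_iA n A \<in> carrier_mat (Suc n) (Suc n)" unfolding In_plus_iA_def by simp
  have "0 = Re ((In_plus_iA n A *\<^sub>v v) \<bullet>c v)"
    using quadratic_form_eigenvector[OF B v(1) ev] l by simp
  also have "\<dots> = (\<Sum>i<n. (cmod (v $ Suc i))\<^sup>2)"
    unfolding In_plus_iA_eq_weighted[OF A] quadratic_form_add_imag[OF weight_mat_carrier A v(1)]
      weight_mat_quadratic_form[OF v(1)] by simp
  finally have "\<forall>i\<in>{..<n}. (cmod (v $ Suc i))\<^sup>2 = 0"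
    by (subst (asm) eq_commute, subst (asm) sum_nonneg_eq_0_iff) auto
  then have z: "v $ Suc i = 0" if "i < n" for i using that by simp
  have v0: "v $ 0 \<noteq> 0"
  proof
    assume "v $ 0 = 0"
    then have "v = 0\<^sub>v (Suc n)" using v(1) z by (intro eq_vecI) (auto simp: less_Suc_eq_0_disj)
    with v(2) show False ..
  qed
  have row: "In_plus_iA n A $$ (i,0) * v $ 0 = l * v $ i" if i: "i < Suc n" for i
  proof -
    have "(In_plus_iA n A *\<^sub>v v) $ i = (\<Sum>j<Suc n. In_plus_iA n A $$ (i,j) * v $ j)"
      using B v(1) i by (simp add: scalar_prod_def atLeast0LessThan del: sum.lessThan_Suc)
    also have "\<dots> = In_plus_iA n A $$ (i,0) * v $ 0"
      using z by (simp add: sum.lessThan_Suc_shift del: sum.lessThan_Suc)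
    finally show ?thesis unfolding ev using v(1) i by simp
  qed
  show "l = \<i> * complex_of_real (A $$ (0,0))"
    using row[of 0] v0 unfolding In_plus_iA_def by simp
  show "A $$ (Suc i, 0) = 0" if "i < n"
    using row[of "Suc i"] z[OF that] v0 that unfolding In_plus_iA_def by simp
qed

text \<open>A kernel vector is an eigenvector for the imaginary eigenvalue 0; conversely, on
  \<open>\<S>\<close> column 0 vanishes.\<close>

lemma det_In_plus_iA_eq_0_iff:
  assumes A: "A \<in> sym_mats (Suc n)"
  shows "det (In_plus_iA n A) = 0 \<longleftrightarrow> in_S n A"
proof
  have B: "In_plus_iA n A \<in> carrier_mat (Suc n) (Suc n)" unfolding In_plus_iA_def by simp
  {
    assume "det (In_plus_iA n A) = 0"
    then obtain v where v: "v \<in> carrier_vec (Suc n)" "v \<noteq> 0\<^sub>v (Suc n)"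
      and "In_plus_iA n A *\<^sub>v v = 0\<^sub>v (Suc n)"
      using det_0_iff_vec_prod_zero_field[OF B] by blast
    then have ev: "In_plus_iA n A *\<^sub>v v = 0 \<cdot>\<^sub>v v" by auto
    note * = In_plus_iA_imaginary_eigenvalue[OF A v ev]
    have "A $$ (i,0) = 0" if "i \<le> n" for i using * that by (cases i) auto
    moreover have "A $$ (0,i) = A $$ (i,0)" if "i \<le> n" for i
      using sym_mats_index[OF A, of 0 i] that by simp
    ultimately show "in_S n A" unfolding in_S_def by simp
  }
  assume "in_S n A"
  then have "In_plus_iA n A $$ (i,0) = 0" if "i < Suc n" for i
    using that unfolding in_S_def In_plus_iA_def by auto
  then show "det (In_plus_iA n A) = 0"
    using laplace_expansion_column[OF B, of 0] by simp
qed

text \<open>The Schur complement of the block \<open>I + \<i> A\<^sup>+\<close> in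
  \<open>I\<^sub>n + \<i> A\<close>.\<close>

definition pivot :: "nat \<Rightarrow> real mat \<Rightarrow> complex" where
  "pivot n A = det (In_plus_iA n A) / det (block_mat n A)"

text \<open>The value at 0 is the largest argument in the closed right half plane, which yields
  upper semicontinuity there, and it matches the summand \<open>pi/2\<close> of \<open>Theta\<close>
  on \<open>\<S>\<close>.\<close>

definition pivot_angle :: "complex \<Rightarrow> real" where
  "pivot_angle s = (if s = 0 then pi / 2 else Arg s)"

lemma det_block_mat_nonzero: "A \<in> sym_mats (Suc n) \<Longrightarrow> det (block_mat n A) \<noteq> 0"
  by (rule strictly_accretive_det_nonzero[OF block_mat_strictly_accretive])

lemma pivot_Re:
  assumes "A \<in> sym_mats (Suc n)"
  shows "0 \<le> Re (pivot n A)"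
  using accretive_pivot_Re[OF weighted_mat_accretive[OF assms order_refl]]
  unfolding pivot_def In_plus_iA_eq_weighted[OF assms] mat_delete_weighted[OF assms] .

lemma pivot_eq_0_iff:
  assumes "A \<in> sym_mats (Suc n)"
  shows "pivot n A = 0 \<longleftrightarrow> in_S n A"
  using det_In_plus_iA_eq_0_iff[OF assms] det_block_mat_nonzero[OF assms] unfolding pivot_def by simp

lemma pivot_angle_le:
  assumes "A \<in> sym_mats (Suc n)"
  shows "pivot_angle (pivot n A) \<le> pi / 2"
  using Arg_half_plane_bound[OF pivot_Re[OF assms]] unfolding pivot_angle_def by fastforce

lemma Theta_off_S:
  assumes "\<not> in_S n A"
  shows "Theta n A = phase (In_plus_iA n A)"
  using assms unfolding Theta_def phase_def by simp

lemma Theta_eq: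
  assumes A: "A \<in> sym_mats (Suc n)"
  shows "Theta n A = phase (block_mat n A) + pivot_angle (pivot n A)"
proof (cases "in_S n A")
  case True
  obtain rs where rs: "spectrum_list n (Aplus n A) rs"
    using sym_mats_spectrum_list[OF Aplus_sym[OF A]] by blast
  then have "char_poly (Aplus n A) = (\<Prod>r\<leftarrow>rs. [:- r, 1:])" unfolding spectrum_list_def by simp
  then have "Theta n A = pi / 2 + (\<Sum>r\<leftarrow>rs. arctan r)"
    unfolding Theta_def using True sum_roots_eq_sum_list[of "char_poly (Aplus n A)" rs arctan] by simp
  then show ?thesis
    using True pivot_eq_0_iff[OF A] phase_one_plus_imag[OF rs] unfolding pivot_angle_def by simp
next
  case False
  have "phase (weighted_mat n 0 A) = phase (block_mat n A) + Arg (pivot n A)"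
    unfolding pivot_def mat_delete_weighted[OF A, of 0, symmetric] In_plus_iA_eq_weighted[OF A]
    using False det_In_plus_iA_eq_0_iff[OF A] block_mat_strictly_accretive[OF A]
    by (intro phase_pivot[where m = n] weighted_mat_accretive A)
      (auto simp: mat_delete_weighted[OF A] In_plus_iA_eq_weighted[OF A])
  then show ?thesis
    using False pivot_eq_0_iff[OF A] unfolding Theta_off_S[OF False] In_plus_iA_eq_weighted[OF A]
      pivot_angle_def by simp
qed

subsection \<open>Semicontinuity and monotonicity of the angle\<close>

lemma block_mat_index:
  assumes "i < n" "j < n"
  shows "block_mat n A $$ (i,j) = (if i = j then 1 else 0) + \<i> * complex_of_real (A $$ (Suc i, Suc j))"
  using assms by (simp add: Aplus_def)

lemma block_phase_tendsto:
  assumes A: "A \<in> sym_mats (Suc n)" and X: "\<And>k. X k \<in> sym_mats (Suc n)"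
    and lim: "\<And>i j. i < Suc n \<Longrightarrow> j < Suc n \<Longrightarrow> (\<lambda>k. X k $$ (i,j)) \<longlonglongrightarrow> A $$ (i,j)"
  shows "(\<lambda>k. phase (block_mat n (X k))) \<longlonglongrightarrow> phase (block_mat n A)"
proof (rule phase_tendsto_strict[OF block_mat_strictly_accretive[OF A] block_mat_strictly_accretive[OF X]])
  show "(\<lambda>k. block_mat n (X k) $$ (i,j)) \<longlonglongrightarrow> block_mat n A $$ (i,j)" if "i < n" "j < n" for i j
    unfolding block_mat_index[OF that] using lim that by (intro tendsto_intros) auto
qed

lemma pivot_tendsto:
  assumes A: "A \<in> sym_mats (Suc n)" and X: "\<And>k. X k \<in> sym_mats (Suc n)"
    and lim: "\<And>i j. i < Suc n \<Longrightarrow> j < Suc n \<Longrightarrow> (\<lambda>k. X k $$ (i,j)) \<longlonglongrightarrow> A $$ (i,j)"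
  shows "(\<lambda>k. pivot n (X k)) \<longlonglongrightarrow> pivot n A"
  unfolding pivot_def
proof (rule tendsto_divide)
  have B: "In_plus_iA n C \<in> carrier_mat (Suc n) (Suc n)" for C unfolding In_plus_iA_def by simp
  have idx: "In_plus_iA n C $$ (i,j) = (if i = j \<and> i \<noteq> 0 then 1 else 0) + \<i> * complex_of_real (C $$ (i,j))"
    if "i < Suc n" "j < Suc n" for C i j using that unfolding In_plus_iA_def by simp
  show "(\<lambda>k. det (In_plus_iA n (X k))) \<longlonglongrightarrow> det (In_plus_iA n A)"
  proof (rule det_tendsto[OF B B])
    show "(\<lambda>k. In_plus_iA n (X k) $$ (i,j)) \<longlonglongrightarrow> In_plus_iA n A $$ (i,j)"
      if "i < Suc n" "j < Suc n" for i j
      unfolding idx[OF that] using lim[OF that] by (intro tendsto_intros)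
  qed
  have D: "block_mat n C \<in> carrier_mat n n" for C by (simp add: Aplus_def)
  show "(\<lambda>k. det (block_mat n (X k))) \<longlonglongrightarrow> det (block_mat n A)"
  proof (rule det_tendsto[OF D D])
    show "(\<lambda>k. block_mat n (X k) $$ (i,j)) \<longlonglongrightarrow> block_mat n A $$ (i,j)" if "i < n" "j < n" for i j
      unfolding block_mat_index[OF that] using lim that by (intro tendsto_intros) auto
  qed
  show "det (block_mat n A) \<noteq> 0" by (rule det_block_mat_nonzero[OF A])
qed

text \<open>At a limit on \<open>\<S>\<close> the pivot angle is maximal, so only the block phase
  has to converge. Off \<open>\<S>\<close> the pivot angle converges as well.\<close>

lemma Theta_upper_semicontinuous:
  assumes A: "A \<in> sym_mats (Suc n)" and X: "\<And>k. X k \<in> sym_mats (Suc n)"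
    and lim: "\<And>i j. i < Suc n \<Longrightarrow> j < Suc n \<Longrightarrow> (\<lambda>k. X k $$ (i,j)) \<longlonglongrightarrow> A $$ (i,j)"
    and le: "\<And>k. c \<le> Theta n (X k)"
  shows "c \<le> Theta n A"
proof (cases "in_S n A")
  case True
  then have eq: "Theta n A = phase (block_mat n A) + pi / 2"
    using pivot_eq_0_iff[OF A] unfolding Theta_eq[OF A] pivot_angle_def by simp
  have "(\<lambda>k. phase (block_mat n (X k)) + pi / 2) \<longlonglongrightarrow> Theta n A"
    unfolding eq by (intro tendsto_intros block_phase_tendsto[OF A X lim])
  moreover have "c \<le> phase (block_mat n (X k)) + pi / 2" for k
    using le[of k] pivot_angle_le[OF X, of k] unfolding Theta_eq[OF X] by linarith
  ultimately show ?thesis by (intro LIMSEQ_le_const) auto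
next
  case False
  then have nz: "pivot n A \<noteq> 0" using pivot_eq_0_iff[OF A] by simp
  then have eq: "Theta n A = phase (block_mat n A) + Arg (pivot n A)"
    unfolding Theta_eq[OF A] pivot_angle_def by simp
  have piv: "(\<lambda>k. pivot n (X k)) \<longlonglongrightarrow> pivot n A" by (rule pivot_tendsto[OF A X lim])
  have "(\<lambda>k. Arg (pivot n (X k))) \<longlonglongrightarrow> Arg (pivot n A)"
    by (rule isCont_tendsto_compose[OF Arg_continuous_half_plane[OF pivot_Re[OF A] nz] piv])
  then have "(\<lambda>k. phase (block_mat n (X k)) + Arg (pivot n (X k))) \<longlonglongrightarrow> Theta n A"
    unfolding eq by (intro tendsto_add block_phase_tendsto[OF A X lim])
  \<comment> \<open>Some \<open>X k\<close> may lie on \<open>\<S>\<close>, where \<open>Arg\<close>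
    of the pivot is not the pivot angle, but only finitely many do because the limit of the pivots
    is nonzero.\<close>
  moreover have "\<forall>\<^sub>F k in sequentially. c \<le> phase (block_mat n (X k)) + Arg (pivot n (X k))"
    using tendsto_imp_eventually_ne[OF piv nz]
  proof eventually_elim
    case (elim k)
    then show ?case using le[of k] unfolding Theta_eq[OF X] pivot_angle_def by simp
  qed
  ultimately show ?thesis by (rule tendsto_lowerbound) simp
qed

lemma weighted_phase_tendsto:
  assumes A: "A \<in> sym_mats (Suc n)" and S: "\<not> in_S n A"
  shows "(\<lambda>k. phase (weighted_mat n (inverse (real (Suc k))) A)) \<longlonglongrightarrow> Theta n A"
proof -
  let ?e = "\<lambda>k. inverse (real (Suc k))"
  have sacc: "strictly_accretive (Suc n) (weighted_mat n (?e k) A)" for k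
    by (intro strictly_accretive_add_imag weight_mat_strictly_accretive A) simp
  have del: "strictly_accretive n (mat_delete (weighted_mat n e A) 0 0)" for e
    unfolding mat_delete_weighted[OF A] by (rule block_mat_strictly_accretive[OF A])
  have nz: "det (weighted_mat n 0 A) \<noteq> 0"
    using S det_In_plus_iA_eq_0_iff[OF A] unfolding In_plus_iA_eq_weighted[OF A] by simp
  have entries: "(\<lambda>k. weighted_mat n (?e k) A $$ (i,j)) \<longlonglongrightarrow> weighted_mat n 0 A $$ (i,j)"
    if "i < Suc n" "j < Suc n" for i j
  proof -
    have idx: "weighted_mat n e A $$ (i,j)
        = (if i = j then (if i = 0 then complex_of_real e else 1) else 0) + \<i> * complex_of_real (A $$ (i,j))" for e
      using that sym_mats_carrier[OF A] by (simp add: weight_mat_def)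
    have "(\<lambda>k. complex_of_real (?e k)) \<longlonglongrightarrow> complex_of_real 0"
      by (intro tendsto_of_real LIMSEQ_inverse_real_of_nat)
    then show ?thesis unfolding idx by (intro tendsto_add) (auto split: if_splits)
  qed
  show ?thesis
    unfolding Theta_off_S[OF S] In_plus_iA_eq_weighted[OF A]
    by (rule phase_tendsto[OF weighted_mat_accretive[OF A order_refl] nz del
          strictly_accretive_imp_accretive[OF sacc] strictly_accretive_det_nonzero[OF sacc] del entries])
qed

lemma psd_mats_sym: "P \<in> psd_mats m \<Longrightarrow> P \<in> sym_mats m"
  unfolding psd_mats_def by simp

lemma sym_mats_add:
  assumes "A \<in> sym_mats m" "B \<in> sym_mats m"
  shows "A + B \<in> sym_mats m"
  using assms by (auto simp: sym_mats_def transpose_add)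

lemma complexify_add:
  assumes "A \<in> carrier_mat m m" "B \<in> carrier_mat m m" "M \<in> carrier_mat m m"
  shows "M + \<i> \<cdot>\<^sub>m complexify (A + B) = (M + \<i> \<cdot>\<^sub>m complexify A) + \<i> \<cdot>\<^sub>m complexify B"
  using assms by (intro eq_matI) (auto simp: algebra_simps)

text \<open>Monotonicity of the phase at positive weight, passed to the limit; the limits at both
  ends are available off \<open>\<S>\<close>.\<close>

lemma Theta_mono_off_S:
  assumes A: "A \<in> sym_mats (Suc n)" and P: "P \<in> psd_mats (Suc n)"
    and S: "\<not> in_S n A" "\<not> in_S n (A + P)"
  shows "Theta n A \<le> Theta n (A + P)"
proof -
  let ?e = "\<lambda>k. inverse (real (Suc k))"
  have Ps: "P \<in> sym_mats (Suc n)" using P by (rule psd_mats_sym)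
  have AP: "A + P \<in> sym_mats (Suc n)" by (rule sym_mats_add[OF A Ps])
  have "phase (weighted_mat n (?e k) A) \<le> phase (weighted_mat n (?e k) (A + P))" for k
    unfolding complexify_add[OF sym_mats_carrier[OF A] sym_mats_carrier[OF Ps] weight_mat_carrier]
    by (intro phase_mono[where m = "Suc n"] strictly_accretive_add_imag
        weight_mat_strictly_accretive A P) simp
  then show ?thesis
    by (intro LIMSEQ_le[OF weighted_phase_tendsto[OF A S(1)] weighted_phase_tendsto[OF AP S(2)]]) auto
qed

lemma Aplus_psd:
  assumes P: "P \<in> psd_mats (Suc n)"
  shows "Aplus n P \<in> psd_mats n"
  unfolding psd_mats_def
proof (intro CollectI conjI ballI)
  show "Aplus n P \<in> sym_mats n" by (rule Aplus_sym[OF psd_mats_sym[OF P]])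
  fix w :: "real vec" assume w: "w \<in> carrier_vec n"
  have Pc: "P \<in> carrier_mat (Suc n) (Suc n)" using P by (intro sym_mats_carrier psd_mats_sym)
  have "w \<bullet> (Aplus n P *\<^sub>v w) = vCons 0 w \<bullet> (P *\<^sub>v vCons 0 w)"
    using w Pc unfolding Aplus_def
    by (simp add: scalar_prod_def mult_mat_vec_def atLeast0LessThan sum.lessThan_Suc_shift
        del: sum.lessThan_Suc)
  then show "0 \<le> w \<bullet> (Aplus n P *\<^sub>v w)" using P w unfolding psd_mats_def by simp
qed

lemma psd_mats_corner:
  assumes P: "P \<in> psd_mats (Suc n)"
  shows "0 \<le> P $$ (0,0)"
proof -
  have Pc: "P \<in> carrier_mat (Suc n) (Suc n)" using P by (intro sym_mats_carrier psd_mats_sym)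
  have "unit_vec (Suc n) 0 \<bullet> (P *\<^sub>v unit_vec (Suc n) 0) = P $$ (0,0)"
    using Pc by (simp add: scalar_prod_left_unit[of _ "Suc n"] scalar_prod_right_unit)
  moreover have "0 \<le> unit_vec (Suc n) 0 \<bullet> (P *\<^sub>v unit_vec (Suc n) 0)"
    using P unfolding psd_mats_def by simp
  ultimately show ?thesis by simp
qed

text \<open>The expansion of the determinant along column 0 has a single nonzero term at
  most.\<close>

lemma pivot_block_diagonal:
  assumes A: "A \<in> sym_mats (Suc n)" and b: "\<And>i. i < n \<Longrightarrow> A $$ (Suc i, 0) = 0"
  shows "pivot n A = \<i> * complex_of_real (A $$ (0,0))"
proof -
  let ?B = "In_plus_iA n A"
  have B: "?B \<in> carrier_mat (Suc n) (Suc n)" unfolding In_plus_iA_def by simp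
  have "?B $$ (Suc i, 0) = 0" if "i < n" for i using that b unfolding In_plus_iA_def by simp
  then have "det ?B = ?B $$ (0,0) * cofactor ?B 0 0"
    using laplace_expansion_column[OF B, of 0] by (simp add: sum.lessThan_Suc_shift del: sum.lessThan_Suc)
  also have "cofactor ?B 0 0 = det (block_mat n A)"
    unfolding cofactor_def In_plus_iA_eq_weighted[OF A] mat_delete_weighted[OF A] by simp
  also have "?B $$ (0,0) = \<i> * complex_of_real (A $$ (0,0))" unfolding In_plus_iA_def by simp
  finally show ?thesis using det_block_mat_nonzero[OF A] unfolding pivot_def by simp
qed

lemma pivot_angle_imaginary:
  "pivot_angle (\<i> * complex_of_real a) = (if 0 \<le> a then pi / 2 else - pi / 2)"
proof (cases "a = 0")
  case False
  have "- (pi / 2) \<le> pi" using pi_gt_zero by linarith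
  then have "Arg (\<i> * complex_of_real a) = (if 0 \<le> a then pi / 2 else - pi / 2)"
    by (intro cis_Arg_unique) (use False in \<open>auto simp: sgn_mult sgn_of_real complex_eq_iff\<close>)
  then show ?thesis using False unfolding pivot_angle_def by simp
qed (simp add: pivot_angle_def)

lemma Theta_block_diagonal:
  assumes "A \<in> sym_mats (Suc n)" "\<And>i. i < n \<Longrightarrow> A $$ (Suc i, 0) = 0"
  shows "Theta n A = phase (block_mat n A) + (if 0 \<le> A $$ (0,0) then pi / 2 else - pi / 2)"
  using Theta_eq[OF assms(1)] pivot_block_diagonal[OF assms] pivot_angle_imaginary by simp

text \<open>A perturbation in the corner entry alone: with \<open>d > 0\<close> it moves a matrix
  off \<open>\<S>\<close> while keeping its angle.\<close>

definition corner_mat :: "nat \<Rightarrow> real \<Rightarrow> real mat" where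
  "corner_mat n d = mat (Suc n) (Suc n) (\<lambda>(i,j). if i = 0 \<and> j = 0 then d else 0)"

lemma corner_mat_sym: "corner_mat n d \<in> sym_mats (Suc n)"
  unfolding corner_mat_def sym_mats_def by auto

lemma corner_mat_index:
  assumes "A \<in> sym_mats (Suc n)" "i < Suc n" "j < Suc n"
  shows "(A + corner_mat n d) $$ (i,j) = A $$ (i,j) + (if i = 0 \<and> j = 0 then d else 0)"
  using assms unfolding corner_mat_def by simp

text \<open>If the sum lies on \<open>\<S>\<close>, its pivot angle is maximal and monotonicity of
  the block phase suffices. If only \<open>A\<close> does, a small positive corner entry moves both
  matrices off \<open>\<S>\<close>, and upper semicontinuity at \<open>A + P\<close> removes it
  again.\<close>

lemma Theta_mono:
  assumes A: "A \<in> sym_mats (Suc n)" and P: "P \<in> psd_mats (Suc n)"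
  shows "Theta n A \<le> Theta n (A + P)"
proof -
  have Ps: "P \<in> sym_mats (Suc n)" using P by (rule psd_mats_sym)
  have AP: "A + P \<in> sym_mats (Suc n)" by (rule sym_mats_add[OF A Ps])
  show ?thesis
  proof (cases "in_S n (A + P)")
    case True
    have "Aplus n (A + P) = Aplus n A + Aplus n P"
      using sym_mats_carrier[OF A] sym_mats_carrier[OF Ps] unfolding Aplus_def by (intro eq_matI) auto
    then have "block_mat n (A + P) = block_mat n A + \<i> \<cdot>\<^sub>m complexify (Aplus n P)"
      using complexify_add[of "Aplus n A" n "Aplus n P" "1\<^sub>m n"] Aplus_sym A Ps sym_mats_carrier
      by (metis one_carrier_mat)
    then have "phase (block_mat n A) \<le> phase (block_mat n (A + P))"
      using phase_mono[OF block_mat_strictly_accretive[OF A] Aplus_psd[OF P]] by simp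
    moreover have "pivot_angle (pivot n (A + P)) = pi / 2"
      using True pivot_eq_0_iff[OF AP] unfolding pivot_angle_def by simp
    ultimately show ?thesis
      unfolding Theta_eq[OF A] Theta_eq[OF AP] using pivot_angle_le[OF A] by linarith
  next
    case nS: False
    show ?thesis
    proof (cases "in_S n A")
      case False
      then show ?thesis using Theta_mono_off_S[OF A P] nS by blast
    next
      case True
      define E where "E k = corner_mat n (inverse (real (Suc k)))" for k
      have A0: "A $$ (0,0) = 0" and Ai: "\<And>i. i < n \<Longrightarrow> A $$ (Suc i, 0) = 0"
        using True unfolding in_S_def by auto
      have AE: "A + E k \<in> sym_mats (Suc n)" and APE: "(A + P) + E k \<in> sym_mats (Suc n)" for k
        unfolding E_def by (intro sym_mats_add A AP corner_mat_sym)+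
      have comm: "(A + P) + E k = (A + E k) + P" for k
        using sym_mats_carrier[OF A] sym_mats_carrier[OF Ps] sym_mats_carrier[OF corner_mat_sym]
        unfolding E_def by (intro eq_matI) (auto simp: corner_mat_def)
      have "Theta n A \<le> Theta n ((A + P) + E k)" for k
      proof -
        let ?d = "inverse (real (Suc k))"
        have "Aplus n (A + E k) = Aplus n A"
          using corner_mat_index[OF A] unfolding Aplus_def E_def by (intro eq_matI) auto
        \<comment> \<open>The pivot becomes a positive multiple of \<open>\<i>\<close>, whose
          argument is the value \<open>pi / 2\<close> assigned at 0.\<close>
        then have "Theta n (A + E k) = Theta n A"
          using Theta_block_diagonal[OF A Ai] Theta_block_diagonal[OF AE, of k]
            corner_mat_index[OF A, of _ 0 ?d] A0 Ai
          unfolding E_def by simp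
        moreover have "0 < (A + E k) $$ (0,0)" "0 < ((A + P) + E k) $$ (0,0)"
          using corner_mat_index[OF A, of 0 0 ?d] corner_mat_index[OF AP, of 0 0 ?d]
            A0 psd_mats_corner[OF P] sym_mats_carrier[OF A] sym_mats_carrier[OF Ps]
          unfolding E_def by (auto simp: add_nonneg_pos)
        then have "\<not> in_S n (A + E k)" "\<not> in_S n ((A + P) + E k)" unfolding in_S_def by force+
        ultimately show ?thesis
          using Theta_mono_off_S[OF AE P, of k] unfolding comm by simp
      qed
      then show ?thesis
      proof (rule Theta_upper_semicontinuous[OF AP APE, rotated])
        fix i j assume ij: "i < Suc n" "j < Suc n"
        have "(\<lambda>k. (A + P) $$ (i,j) + (if i = 0 \<and> j = 0 then inverse (real (Suc k)) else 0))
            \<longlonglongrightarrow> (A + P) $$ (i,j) + 0"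
          using tendsto_add[OF tendsto_const LIMSEQ_inverse_real_of_nat, of "(A + P) $$ (i,j)"]
          by (cases "i = 0 \<and> j = 0") auto
        then show "(\<lambda>k. ((A + P) + E k) $$ (i,j)) \<longlonglongrightarrow> (A + P) $$ (i,j)"
          unfolding E_def corner_mat_index[OF AP ij] by simp
      qed
    qed
  qed
qed

subsection \<open>Negation, strict monotonicity and the dual\<close>

lemma sym_mats_uminus:
  assumes "A \<in> sym_mats m"
  shows "- A \<in> sym_mats m"
  using assms by (auto simp: sym_mats_def transpose_uminus)

text \<open>One formula serves negation, the shift by a multiple of the identity, and (with
  \<open>t = 0\<close>) scalar matrices.\<close>

lemma phase_block_mat_affine:
  assumes rs: "spectrum_list n (Aplus n A) rs"
    and eq: "\<And>i j. i < Suc n \<Longrightarrow> j < Suc n \<Longrightarrow> B $$ (i,j) = (if i = j then a else 0) + t * A $$ (i,j)"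
  shows "phase (block_mat n B) = (\<Sum>r\<leftarrow>rs. arctan (a + t * r))"
proof -
  have "Aplus n B = a \<cdot>\<^sub>m 1\<^sub>m n + t \<cdot>\<^sub>m Aplus n A"
    using eq unfolding Aplus_def by (intro eq_matI) auto
  then have "spectrum_list n (Aplus n B) (map (\<lambda>r. a + t * r) rs)"
    using spectrum_list_affine[OF rs, of a t] by simp
  from phase_one_plus_imag[OF this] show ?thesis by (simp add: o_def)
qed

lemma phase_block_mat_uminus:
  assumes A: "A \<in> sym_mats (Suc n)"
  shows "phase (block_mat n (- A)) = - phase (block_mat n A)"
proof -
  obtain rs where rs: "spectrum_list n (Aplus n A) rs"
    using sym_mats_spectrum_list[OF Aplus_sym[OF A]] by blast
  have "phase (block_mat n (- A)) = (\<Sum>r\<leftarrow>rs. arctan (0 + (- 1) * r))"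
    by (rule phase_block_mat_affine[OF rs])
      (use sym_mats_carrier[OF A] in auto)
  then show ?thesis
    unfolding phase_one_plus_imag[OF rs] by (simp add: arctan_minus uminus_sum_list_map o_def)
qed

text \<open>As \<open>A\<close> is real, negating it conjugates both matrices, and determinants
  commute with conjugation.\<close>

lemma pivot_uminus:
  assumes A: "A \<in> sym_mats (Suc n)"
  shows "pivot n (- A) = cnj (pivot n A)"
proof -
  interpret cnj: comm_ring_hom cnj by unfold_locales auto
  have Ac: "A \<in> carrier_mat (Suc n) (Suc n)" by (rule sym_mats_carrier[OF A])
  have "In_plus_iA n (- A) = map_mat cnj (In_plus_iA n A)"
    using Ac unfolding In_plus_iA_def by (intro eq_matI) auto
  moreover have "block_mat n (- A) = map_mat cnj (block_mat n A)"
    using Ac unfolding Aplus_def by (intro eq_matI) auto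
  ultimately show ?thesis unfolding pivot_def by simp
qed

lemma Arg_cnj_half_plane:
  assumes "0 \<le> Re s"
  shows "Arg (cnj s) = - Arg s"
  using assms by (auto simp: Arg_cnj Arg_real complex_is_Real_iff)

text \<open>The block phases cancel. Off \<open>\<S>\<close> the pivot angles cancel too; on
  \<open>\<S>\<close> both are \<open>pi / 2\<close>.\<close>

lemma Theta_uminus_ge:
  assumes A: "A \<in> sym_mats (Suc n)"
  shows "- Theta n A \<le> Theta n (- A)"
  unfolding Theta_eq[OF A] Theta_eq[OF sym_mats_uminus[OF A]] phase_block_mat_uminus[OF A] pivot_uminus[OF A]
  using Arg_cnj_half_plane[OF pivot_Re[OF A]] unfolding pivot_angle_def by simp

lemma Theta_uminus_off_S:
  assumes A: "A \<in> sym_mats (Suc n)" and S: "\<not> in_S n A"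
  shows "Theta n (- A) = - Theta n A"
  unfolding Theta_eq[OF A] Theta_eq[OF sym_mats_uminus[OF A]] phase_block_mat_uminus[OF A] pivot_uminus[OF A]
  using Arg_cnj_half_plane[OF pivot_Re[OF A]] S pivot_eq_0_iff[OF A] unfolding pivot_angle_def by simp

lemma Arg_shift_down_less:
  assumes "0 < Re z" "0 < e"
  shows "Arg (z - \<i> * complex_of_real e) < Arg z"
  using assms by (simp add: arg_conv_arctan arctan_less_iff divide_strict_right_mono)

text \<open>The full identity is subtracted, corner included, so that every eigenvalue of
  \<open>In_plus_iA\<close> moves by exactly \<open>- \<i> e\<close>.\<close>

definition scalar_shift :: "nat \<Rightarrow> real \<Rightarrow> real mat \<Rightarrow> real mat" where
  "scalar_shift n e A = A - e \<cdot>\<^sub>m 1\<^sub>m (Suc n)"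

lemma scalar_shift_index:
  assumes "A \<in> sym_mats (Suc n)" "i < Suc n" "j < Suc n"
  shows "scalar_shift n e A $$ (i,j) = A $$ (i,j) - (if i = j then e else 0)"
  using assms sym_mats_carrier unfolding scalar_shift_def by simp

lemma scalar_shift_sym:
  assumes "A \<in> sym_mats (Suc n)"
  shows "scalar_shift n e A \<in> sym_mats (Suc n)"
proof -
  have c: "scalar_shift n e A \<in> carrier_mat (Suc n) (Suc n)"
    unfolding scalar_shift_def by (intro minus_carrier_mat) simp
  moreover have "transpose_mat (scalar_shift n e A) = scalar_shift n e A"
    using c by (intro eq_matI)
      (auto simp: scalar_shift_index[OF assms] sym_mats_index[OF assms])
  ultimately show ?thesis unfolding sym_mats_def by simp
qed

text \<open>A nonzero entry of column 0 below the corner excludes imaginary eigenvalues. In the open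
  right half plane moving straight down strictly lowers the argument.\<close>

lemma phase_In_plus_iA_shift_less:
  assumes A: "A \<in> sym_mats (Suc n)" and b: "i < n" "A $$ (Suc i, 0) \<noteq> 0" and e: "0 < e"
  shows "phase (In_plus_iA n (scalar_shift n e A)) < phase (In_plus_iA n A)"
proof -
  have B: "In_plus_iA n A \<in> carrier_mat (Suc n) (Suc n)" unfolding In_plus_iA_def by simp
  obtain as where as: "spectrum_list (Suc n) (In_plus_iA n A) as" using spectrum_list_exists[OF B] by blast
  have pos: "0 < Re a" if a: "a \<in> set as" for a
  proof -
    have "0 \<le> Re a"
      using accretive_eigenvalue_Re[OF _ as a] weighted_mat_accretive[OF A order_refl]
      unfolding In_plus_iA_eq_weighted[OF A] by blast
    moreover have "Re a \<noteq> 0"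
    proof
      assume "Re a = 0"
      moreover obtain v where "v \<in> carrier_vec (Suc n)" "v \<noteq> 0\<^sub>v (Suc n)" "In_plus_iA n A *\<^sub>v v = a \<cdot>\<^sub>v v"
        using spectrum_list_eigenvector[OF as a] by blast
      ultimately show False using In_plus_iA_imaginary_eigenvalue(1)[OF A _ _ _ _ b(1)] b(2) by blast
    qed
    ultimately show ?thesis by simp
  qed
  have "In_plus_iA n (scalar_shift n e A)
      = (- \<i> * complex_of_real e) \<cdot>\<^sub>m 1\<^sub>m (Suc n) + 1 \<cdot>\<^sub>m In_plus_iA n A"
    unfolding In_plus_iA_def
    by (intro eq_matI) (auto simp: scalar_shift_index[OF A] algebra_simps)
  then have "spectrum_list (Suc n) (In_plus_iA n (scalar_shift n e A)) (map (\<lambda>a. a - \<i> * complex_of_real e) as)"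
    using spectrum_list_affine[OF as, of "- \<i> * complex_of_real e" 1] by simp
  from phase_eq_sum_list[OF this]
  have "phase (In_plus_iA n (scalar_shift n e A)) = (\<Sum>a\<leftarrow>as. Arg (a - \<i> * complex_of_real e))"
    by (simp add: o_def)
  also have "\<dots> < (\<Sum>a\<leftarrow>as. Arg a)"
    using as Arg_shift_down_less[OF pos e] unfolding spectrum_list_def
    by (intro sum_list_strict_mono) auto
  finally show ?thesis unfolding phase_eq_sum_list[OF as] .
qed

text \<open>The strict inequality needed for interior points. With a nonzero entry beside the corner
  it comes from the shifted eigenvalues; otherwise the angles are explicit and it comes from the
  arctangents of the block.\<close>

lemma Theta_shift_less:
  assumes A: "A \<in> sym_mats (Suc n)" and e: "0 < e"
    and le: "c \<le> Theta n (scalar_shift n e A)" and c: "\<bar>c\<bar> < real (Suc n) * pi / 2"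
  shows "Theta n (- A) < - c"
proof (cases "\<exists>i<n. A $$ (Suc i, 0) \<noteq> 0")
  case True
  then obtain i where i: "i < n" "A $$ (Suc i, 0) \<noteq> 0" by blast
  then have "\<not> in_S n A" "\<not> in_S n (scalar_shift n e A)"
    using scalar_shift_index[OF A, of "Suc i" 0 e] unfolding in_S_def by force+
  then show ?thesis
    using le phase_In_plus_iA_shift_less[OF A i e] Theta_uminus_off_S[OF A] by (simp add: Theta_off_S)
next
  case False
  then have b: "\<And>i. i < n \<Longrightarrow> A $$ (Suc i, 0) = 0" by blast
  have Ac: "A \<in> carrier_mat (Suc n) (Suc n)" by (rule sym_mats_carrier[OF A])
  obtain rs where rs: "spectrum_list n (Aplus n A) rs"
    using sym_mats_spectrum_list[OF Aplus_sym[OF A]] by blast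
  have "Theta n (scalar_shift n e A)
      = phase (block_mat n (scalar_shift n e A)) + (if e \<le> A $$ (0,0) then pi / 2 else - pi / 2)"
    using Theta_block_diagonal[OF scalar_shift_sym[OF A]] b by (simp add: scalar_shift_index[OF A])
  also have "phase (block_mat n (scalar_shift n e A)) = (\<Sum>r\<leftarrow>rs. arctan (- e + 1 * r))"
    by (rule phase_block_mat_affine[OF rs]) (simp add: scalar_shift_index[OF A])
  finally have shift: "Theta n (scalar_shift n e A)
      = (\<Sum>r\<leftarrow>rs. arctan (r - e)) + (if e \<le> A $$ (0,0) then pi / 2 else - pi / 2)" by simp
  have "Theta n (- A) = phase (block_mat n (- A)) + (if 0 \<le> (- A) $$ (0,0) then pi / 2 else - pi / 2)"
    by (rule Theta_block_diagonal[OF sym_mats_uminus[OF A]]) (use Ac b in simp)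
  then have neg: "Theta n (- A) = - (\<Sum>r\<leftarrow>rs. arctan r) + (if A $$ (0,0) \<le> 0 then pi / 2 else - pi / 2)"
    unfolding phase_block_mat_uminus[OF A] phase_one_plus_imag[OF rs] using Ac by simp
  show ?thesis
  proof (cases "n = 0")
    case True
    then have "rs = []" using rs unfolding spectrum_list_def by simp
    \<comment> \<open>Here all angles are \<open>pi / 2\<close> or \<open>- pi / 2\<close>. As
      \<open>c > - pi / 2\<close>, the shifted angle is \<open>pi / 2\<close>, so the entry of
      \<open>A\<close> is positive and \<open>- A\<close> has angle
      \<open>- pi / 2 < - c\<close>.\<close>
    then show ?thesis using le c e shift neg True by (auto split: if_splits)
  next
    case False
    then have "rs \<noteq> []" using rs unfolding spectrum_list_def by auto
    then have "(\<Sum>r\<leftarrow>rs. arctan (r - e)) < (\<Sum>r\<leftarrow>rs. arctan r)"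
      using e by (intro sum_list_strict_mono) (auto simp: arctan_less_iff)
    \<comment> \<open>If the left side is \<open>pi / 2\<close>, then the corner is at least
      \<open>e > 0\<close>, so the right side is \<open>pi / 2\<close> too.\<close>
    moreover have "(if e \<le> A $$ (0,0) then pi / 2 else - pi / 2)
        \<le> - (if A $$ (0,0) \<le> 0 then pi / 2 else - pi / 2)"
      using e by simp
    ultimately show ?thesis using le unfolding shift neg by linarith
  qed
qed

lemma Theta_scalar:
  assumes "t \<noteq> 0"
  shows "Theta n (t \<cdot>\<^sub>m 1\<^sub>m (Suc n)) = real n * arctan t + sgn t * (pi / 2)"
proof -
  let ?A = "t \<cdot>\<^sub>m 1\<^sub>m (Suc n) :: real mat"
  have A: "?A \<in> sym_mats (Suc n)" unfolding sym_mats_def by (auto intro!: eq_matI)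
  obtain rs where rs: "spectrum_list n (Aplus n ?A) rs"
    using sym_mats_spectrum_list[OF Aplus_sym[OF A]] by blast
  then have len: "length rs = n" unfolding spectrum_list_def by simp
  have "phase (block_mat n ?A) = (\<Sum>r\<leftarrow>rs. arctan (t + 0 * r))"
    by (rule phase_block_mat_affine[OF rs]) simp
  then have "phase (block_mat n ?A) = real n * arctan t"
    using len by (simp add: sum_list_triv)
  moreover have "Theta n ?A = phase (block_mat n ?A) + (if 0 \<le> ?A $$ (0,0) then pi / 2 else - pi / 2)"
    by (rule Theta_block_diagonal[OF A]) simp
  ultimately show ?thesis using assms by (auto simp: sgn_if)
qed

text \<open>The angle of \<open>t I\<close> tends to \<open>(n + 1) * pi / 2\<close>. The absolute
  value lets one \<open>t\<close> provide both a member \<open>t I\<close> and a non-member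
  \<open>- t I\<close> of \<open>Fc n c\<close>.\<close>

lemma exists_scalar_angle:
  assumes "\<bar>c\<bar> < real (Suc n) * pi / 2"
  shows "\<exists>t>0. \<bar>c\<bar> < real n * arctan t + pi / 2"
proof -
  have "((\<lambda>t. real n * arctan t + pi / 2) \<longlongrightarrow> real n * (pi / 2) + pi / 2) at_top"
    by (intro tendsto_intros tendsto_arctan_at_top)
  moreover have "\<bar>c\<bar> < real n * (pi / 2) + pi / 2" using assms by (simp add: algebra_simps add_divide_distrib)
  ultimately have "\<forall>\<^sub>F t in at_top. \<bar>c\<bar> < real n * arctan t + pi / 2" by (rule order_tendstoD(1))
  then have "\<forall>\<^sub>F t in at_top. 0 < t \<and> \<bar>c\<bar> < real n * arctan t + pi / 2"
    using eventually_gt_at_top[of 0] by eventually_elim simp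
  then show ?thesis using eventually_happens trivial_limit_at_top_linorder by blast
qed

section \<open>The subequation property, the interior and the dual\<close>

lemma subequation_Fc:
  assumes c: "\<bar>c\<bar> < real (Suc n) * pi / 2"
  shows "subequation (Suc n) (Fc n c)"
  unfolding subequation_def
proof (intro conjI ballI)
  obtain t where t: "0 < t" "\<bar>c\<bar> < real n * arctan t + pi / 2" using exists_scalar_angle[OF c] by blast
  have sym: "s \<cdot>\<^sub>m 1\<^sub>m (Suc n) \<in> sym_mats (Suc n)" for s
    unfolding sym_mats_def by (auto intro!: eq_matI)
  show "Fc n c \<subseteq> sym_mats (Suc n)" unfolding Fc_def by auto
  have "c \<le> Theta n (t \<cdot>\<^sub>m 1\<^sub>m (Suc n))" using t Theta_scalar[of t n] by simp
  then show "Fc n c \<noteq> {}" unfolding Fc_def using sym by auto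
  have "Theta n ((- t) \<cdot>\<^sub>m 1\<^sub>m (Suc n)) < c"
    using t Theta_scalar[of "- t" n] by (simp add: arctan_minus)
  then have "(- t) \<cdot>\<^sub>m 1\<^sub>m (Suc n) \<notin> Fc n c" unfolding Fc_def by simp
  then show "Fc n c \<noteq> sym_mats (Suc n)" using sym[of "- t"] by blast
  show "closed_sym (Suc n) (Fc n c)"
    unfolding closed_sym_def
  proof (intro allI impI, elim conjE)
    fix X A assume X: "\<forall>k. X k \<in> Fc n c" and A: "A \<in> sym_mats (Suc n)"
      and lim: "\<forall>i<Suc n. \<forall>j<Suc n. (\<lambda>k. X k $$ (i,j)) \<longlonglongrightarrow> A $$ (i,j)"
    have "c \<le> Theta n A"
      by (rule Theta_upper_semicontinuous[OF A, of X]) (use X lim in \<open>auto simp: Fc_def\<close>)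
    then show "A \<in> Fc n c" using A unfolding Fc_def by simp
  qed
  fix A P assume "A \<in> Fc n c" "P \<in> psd_mats (Suc n)"
  then show "A + P \<in> Fc n c"
    using Theta_mono[of A n P] sym_mats_add[of A "Suc n" P] psd_mats_sym[of P "Suc n"]
    unfolding Fc_def by auto
qed

lemma uminus_uminus_sym:
  assumes "A \<in> sym_mats m"
  shows "- (- A) = A"
  using sym_mats_carrier[OF assms] by (intro eq_matI) auto

text \<open>An interior point stays in the set after a small downward shift, which makes the
  inequality strict. Conversely, if points outside converge to \<open>A\<close>, their negatives
  have angle at least \<open>- c\<close>, and upper semicontinuity carries this bound to
  \<open>- A\<close>.\<close>

lemma int_sym_Fc:
  assumes c: "\<bar>c\<bar> < real (Suc n) * pi / 2" and A: "A \<in> sym_mats (Suc n)"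
  shows "A \<in> int_sym (Suc n) (Fc n c) \<longleftrightarrow> Theta n (- A) < - c"
proof
  assume "A \<in> int_sym (Suc n) (Fc n c)"
  then obtain e where e: "0 < e" and ball: "\<And>B. B \<in> sym_mats (Suc n) \<Longrightarrow>
      (\<forall>i<Suc n. \<forall>j<Suc n. \<bar>B $$ (i,j) - A $$ (i,j)\<bar> < e) \<Longrightarrow> B \<in> Fc n c"
    unfolding int_sym_def by blast
  have "scalar_shift n (e / 2) A \<in> Fc n c"
    by (rule ball[OF scalar_shift_sym[OF A]]) (use e in \<open>auto simp: scalar_shift_index[OF A]\<close>)
  then show "Theta n (- A) < - c"
    using Theta_shift_less[OF A, of "e / 2" c] c e unfolding Fc_def by simp
next
  assume less: "Theta n (- A) < - c"
  show "A \<in> int_sym (Suc n) (Fc n c)"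
  proof (rule ccontr)
    assume "A \<notin> int_sym (Suc n) (Fc n c)"
    then have "\<exists>B. B \<in> sym_mats (Suc n) \<and> (\<forall>i<Suc n. \<forall>j<Suc n. \<bar>B $$ (i,j) - A $$ (i,j)\<bar> < e)
        \<and> B \<notin> Fc n c" if "0 < e" for e
      using A that unfolding int_sym_def by blast
    then have "\<forall>k. \<exists>B. B \<in> sym_mats (Suc n) \<and> (\<forall>i<Suc n. \<forall>j<Suc n. \<bar>B $$ (i,j) - A $$ (i,j)\<bar> < inverse (real (Suc k)))
        \<and> B \<notin> Fc n c" by simp
    then obtain B where B: "\<And>k. B k \<in> sym_mats (Suc n)"
      and near: "\<And>k i j. i < Suc n \<Longrightarrow> j < Suc n \<Longrightarrow> \<bar>B k $$ (i,j) - A $$ (i,j)\<bar> < inverse (real (Suc k))"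
      and out: "\<And>k. B k \<notin> Fc n c" by metis
    have "- c \<le> Theta n (- A)"
    proof (rule Theta_upper_semicontinuous[OF sym_mats_uminus[OF A] sym_mats_uminus[OF B]])
      fix i j assume ij: "i < Suc n" "j < Suc n"
      have "(\<lambda>k. B k $$ (i,j) - A $$ (i,j)) \<longlonglongrightarrow> 0"
        by (rule Lim_null_comparison[OF always_eventually LIMSEQ_inverse_real_of_nat])
          (use near[OF ij] in \<open>simp add: less_imp_le\<close>)
      then have "(\<lambda>k. - B k $$ (i,j)) \<longlonglongrightarrow> - A $$ (i,j)"
        by (intro tendsto_minus) (simp add: LIM_zero_iff)
      then show "(\<lambda>k. (- B k) $$ (i,j)) \<longlonglongrightarrow> (- A) $$ (i,j)"
        using ij by (simp add: carrier_matD[OF sym_mats_carrier[OF A]] carrier_matD[OF sym_mats_carrier[OF B]])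
    next
      fix k
      have "Theta n (B k) < c" using out[of k] B[of k] unfolding Fc_def by simp
      then show "- c \<le> Theta n (- B k)" using Theta_uminus_ge[OF B, of k] by linarith
    qed
    with less show False by simp
  qed
qed

theorem theorem5p1:
  fixes n :: nat and c :: real
  assumes "\<bar>c\<bar> < real (n+1) * pi / 2"
  shows "subequation (n+1) (Fc n c) \<and> dual_subeq (n+1) (Fc n c) = Fc n (-c)"
proof
  have c: "\<bar>c\<bar> < real (Suc n) * pi / 2" using assms by simp
  show "subequation (n+1) (Fc n c)" using subequation_Fc[OF c] by simp
  \<comment> \<open>The description of the interior is applied to \<open>- A\<close>, so that the
    angle of \<open>A\<close> itself appears.\<close>
  have "A \<in> dual_subeq (Suc n) (Fc n c) \<longleftrightarrow> A \<in> Fc n (- c)" for A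
    using int_sym_Fc[OF c sym_mats_uminus, of A] uminus_uminus_sym[of A "Suc n"]
    unfolding dual_subeq_def Fc_def by auto
  then show "dual_subeq (n+1) (Fc n c) = Fc n (-c)" by auto
qed

end
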